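(* Let $0<\varepsilon\le\frac1{24}$, let $n,k$ be positive integers with $n\ge k/\varepsilon$, and let $\mathcal F\subset\binom{[n]}{k}$ be an intersecting family with $|\mathcal F|\ge 36\binom{n-3}{k-3}$. Then $\varrho(\mathcal F)>\frac23-\varepsilon$.
   Context: $[n]=\{1,\dots,n\}$; $\binom{[n]}{k}$ is the set of $k$-subsets of $[n]$. $\mathcal F$ is intersecting if $F\cap F'\ne\emptyset$ for all $F,F'\in\mathcal F$. For $i\in[n]$, $\mathcal F(i)=\{F\setminus\{i\}: i\in F\in\mathcal F\}$, and $\varrho(\mathcal F)=\max_{i\in[n]}|\mathcal F(i)|/|\mathcal F|$. Binomial coefficients $\binom{m}{j}$ are $0$ when $j<0$ or $j>m$. *)

theory Defs
  imports Complex_Main "HOL-Library.Ramsey"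
begin

definition intersecting :: "'a set set \<Rightarrow> bool" where
  "intersecting \<F> \<longleftrightarrow> (\<forall>F\<in>\<F>. \<forall>F'\<in>\<F>. F \<inter> F' \<noteq> {})"

definition link :: "'a set set \<Rightarrow> 'a \<Rightarrow> 'a set set" where
  "link \<F> i = {F - {i} | F. i \<in> F \<and> F \<in> \<F>}"

text \<open>The maximum of an empty set, and the quotient for an empty family, are not
  meaningful: \<open>max_rel_degree n \<F>\<close> is used only for \<open>n \<ge> 1\<close> and \<open>\<F>\<close> finite and nonempty.\<close>

definition max_rel_degree :: "nat \<Rightarrow> nat set set \<Rightarrow> real" where
  "max_rel_degree n \<F> = Max ((\<lambda>i. real (card (link \<F> i)) / real (card \<F>)) ` {1..n})"

text \<open>Integer arguments, since truncated subtraction would turn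
  \<open>(n - 3) choose (k - 3)\<close> into \<open>1\<close> rather than \<open>0\<close> for \<open>k < 3\<close>.\<close>

definition binom :: "int \<Rightarrow> int \<Rightarrow> nat" where
  "binom m j = (if j < 0 \<or> m < j then 0 else nat m choose nat j)"

end

theory Submission
  imports Defs
begin

text \<open>Write \<open>C\<close> for \<open>(n - 3) choose (k - 3)\<close>; the ratio \<open>k / n\<close> is at most \<open>1 / 24\<close>, so fixing one more
  element of a \<open>k\<close>-set costs a factor of at least 24. Shifting shows that if one of two
  cross-intersecting families has more than about \<open>s\<close> times the size of a full star, then every
  member of the shifted other family contains a large part of some initial segment, and that family
  has only about the size of the sets containing \<open>s + 1\<close> fixed elements.

  Such gaps force a rigid structure on an intersecting family with more than \<open>35 C\<close> members: either
  all but \<open>7 C\<close> members contain one element, or there is a triple such that each of its three pairs is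
  the trace of more than \<open>6.5 C\<close> members. Shifting does not preserve the maximum degree, but it
  reflects this structure: when it holds after a single shift, a weak form of it (with \<open>16 C\<close>, or with
  only two heavy pairs) holds before, and the gaps upgrade the weak form to the strong one.
  Since a fully shifted family has the weak form, every family has the strong one.
  In the first case the degree of that element is at least four fifths of the family; in the second, almost
  every member meets the triple at least twice, so some degree is almost two thirds.\<close>

subsection \<open>Shifting\<close>

definition cross_intersecting :: "'a set set \<Rightarrow> 'a set set \<Rightarrow> bool" where
  "cross_intersecting A B \<longleftrightarrow> (\<forall>a\<in>A. \<forall>b\<in>B. a \<inter> b \<noteq> {})"

lemma cross_intersecting_sym: "cross_intersecting A B \<Longrightarrow> cross_intersecting B A"
  unfolding cross_intersecting_def by blast

text \<open>The compression replacing \<open>j\<close> by \<open>i\<close>. A set whose image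
  already lies in \<open>A\<close> stays put, which keeps the map injective on
  \<open>A\<close>.\<close>

definition shift_set :: "nat \<Rightarrow> nat \<Rightarrow> nat set set \<Rightarrow> nat set \<Rightarrow> nat set" where
  "shift_set i j A f =
    (if j \<in> f \<and> i \<notin> f \<and> insert i (f - {j}) \<notin> A then insert i (f - {j}) else f)"

definition shift :: "nat \<Rightarrow> nat \<Rightarrow> nat set set \<Rightarrow> nat set set" where
  "shift i j A = shift_set i j A ` A"

definition shifted :: "nat set \<Rightarrow> nat set set \<Rightarrow> bool" where
  "shifted X A \<longleftrightarrow> (\<forall>i\<in>X. \<forall>j\<in>X. \<forall>f\<in>A. i < j \<longrightarrow> j \<in> f \<longrightarrow> i \<notin> f \<longrightarrow> insert i (f - {j}) \<in> A)"

lemma not_shiftedE: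
  assumes "\<not> shifted X A"
  obtains i j f where "i \<in> X" "j \<in> X" "i < j" "f \<in> A" "shift_set i j A f \<noteq> f"
proof -
  obtain i j f where *: "i \<in> X" "j \<in> X" "i < j" "f \<in> A" "j \<in> f" "i \<notin> f" "insert i (f - {j}) \<notin> A"
    using assms unfolding shifted_def by blast
  then have "shift_set i j A f \<noteq> f" unfolding shift_set_def by auto
  then show ?thesis using * that by blast
qed

text \<open>Moved sets land outside \<open>A\<close> and the others stay in \<open>A\<close>, so two
  sets with equal images are both moved or both fixed. A moved set is recovered from its image by
  putting \<open>j\<close> back for \<open>i\<close>.\<close>

lemma inj_on_shift_set: "inj_on (shift_set i j A) A"
proof (rule inj_onI)
  fix f g assume fg: "f \<in> A" "g \<in> A" "shift_set i j A f = shift_set i j A g"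
  have eq: "f = g" if "j \<in> f" "i \<notin> f" "j \<in> g" "i \<notin> g" "insert i (f - {j}) = insert i (g - {j})"
    for f g :: "nat set"
    using that by (metis Diff_insert_absorb Diff_iff insert_Diff)
  show "f = g"
  proof (cases "shift_set i j A f = f")
    case f: True
    show ?thesis
    proof (cases "shift_set i j A g = g")
      case False
      then have "shift_set i j A g \<notin> A" unfolding shift_set_def by (simp split: if_splits)
      then show ?thesis using fg f by simp
    qed (use fg f in simp)
  next
    case f: False
    then have nf: "shift_set i j A f \<notin> A" "j \<in> f" "i \<notin> f" "shift_set i j A f = insert i (f - {j})"
      unfolding shift_set_def by (simp_all split: if_splits)
    then have "shift_set i j A g \<noteq> g" using fg by auto
    then have "j \<in> g" "i \<notin> g" "shift_set i j A g = insert i (g - {j})"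
      unfolding shift_set_def by (simp_all split: if_splits)
    then show ?thesis using eq nf fg by simp
  qed
qed

lemma card_shift: "card (shift i j A) = card A"
  unfolding shift_def by (rule card_image[OF inj_on_shift_set])

lemma shift_subset_nsets:
  assumes "A \<subseteq> nsets X a" "i \<in> X"
  shows "shift i j A \<subseteq> nsets X a"
proof -
  have "shift_set i j A f \<in> nsets X a" if "f \<in> A" for f
  proof -
    have f: "f \<subseteq> X" "finite f" "card f = a" using that assms(1) by (auto simp: nsets_def)
    have "card (insert i (f - {j})) = a" if "j \<in> f" "i \<notin> f"
      using that f by (metis Diff_iff card_Suc_Diff1 card_insert_disjoint finite_Diff)
    then show ?thesis using f assms(2) unfolding shift_set_def nsets_def by auto
  qed
  then show ?thesis unfolding shift_def by auto
qed

text \<open>A moved \<open>a\<close> loses only \<open>j\<close>. If its image missed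
  \<open>b\<close>, then \<open>b\<close> would contain \<open>j\<close> but not \<open>i\<close>;
  since \<open>b\<close> stays, its own compression is already in \<open>B\<close>, and that set
  would miss \<open>a\<close>.\<close>

lemma shift_set_inter_nonempty:
  assumes "cross_intersecting A B" "a \<in> A" "b \<in> B" "shift_set i j B b = b"
  shows "shift_set i j A a \<inter> b \<noteq> {}"
proof (cases "shift_set i j A a = a")
  case True
  then show ?thesis using assms unfolding cross_intersecting_def by auto
next
  case False
  then have a: "j \<in> a" "i \<notin> a" "shift_set i j A a = insert i (a - {j})"
    unfolding shift_set_def by (auto split: if_splits)
  show ?thesis
  proof
    assume e: "shift_set i j A a \<inter> b = {}"
    have ab: "a \<inter> b \<noteq> {}" using assms unfolding cross_intersecting_def by auto
    have "j \<in> b" "i \<notin> b" using e ab a by auto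
    then have "insert i (b - {j}) \<in> B"
      using assms(4) a(1) unfolding shift_set_def by (auto split: if_splits)
    then have "a \<inter> insert i (b - {j}) \<noteq> {}"
      using assms unfolding cross_intersecting_def by blast
    then show False using e a by auto
  qed
qed

text \<open>Two moved sets share \<open>i\<close>; in all other cases one of the two stays.\<close>

lemma cross_intersecting_shift:
  assumes "cross_intersecting A B"
  shows "cross_intersecting (shift i j A) (shift i j B)"
proof -
  have "shift_set i j A a \<inter> shift_set i j B b \<noteq> {}" if ab: "a \<in> A" "b \<in> B" for a b
  proof (cases "shift_set i j B b = b")
    case True
    then show ?thesis using shift_set_inter_nonempty[OF assms ab] by simp
  next
    case b: False
    show ?thesis
    proof (cases "shift_set i j A a = a")
      case True
      then show ?thesis
        using shift_set_inter_nonempty[OF cross_intersecting_sym[OF assms] ab(2,1)]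
        by (simp add: Int_commute)
    next
      case False
      then have "i \<in> shift_set i j A a" "i \<in> shift_set i j B b"
        using b unfolding shift_set_def by (auto split: if_splits)
      then show ?thesis by blast
    qed
  qed
  then show ?thesis unfolding cross_intersecting_def shift_def by auto
qed

lemma card_shift_Collect_le:
  assumes "finite A"
  shows "card {g \<in> shift i j A. P g}
    \<le> card {f \<in> A. P f \<or> (j \<in> f \<and> i \<notin> f \<and> P (insert i (f - {j})))}"
proof -
  have "{g \<in> shift i j A. P g} \<subseteq>
    shift_set i j A ` {f \<in> A. P f \<or> (j \<in> f \<and> i \<notin> f \<and> P (insert i (f - {j})))}"
    unfolding shift_def shift_set_def by (auto split: if_splits)
  then have "card {g \<in> shift i j A. P g} \<le> card (shift_set i j A `
      {f \<in> A. P f \<or> (j \<in> f \<and> i \<notin> f \<and> P (insert i (f - {j})))})"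
    using assms by (intro card_mono) auto
  also have "\<dots> \<le> card {f \<in> A. P f \<or> (j \<in> f \<and> i \<notin> f \<and> P (insert i (f - {j})))}"
    using assms by (intro card_image_le) auto
  finally show ?thesis .
qed

lemma card_split_member:
  assumes "finite F"
  shows "card F = card {f \<in> F. x \<in> f} + card {f \<in> F. x \<notin> f}"
proof -
  have "F = {f \<in> F. x \<in> f} \<union> {f \<in> F. x \<notin> f}" by auto
  then show ?thesis
    using assms card_Un_disjoint[of "{f \<in> F. x \<in> f}" "{f \<in> F. x \<notin> f}"] by auto
qed

text \<open>Only the degree of \<open>i\<close> can grow under the shift, while the number of
  members is constant.\<close>

lemma card_avoiding_le_shift:
  assumes "finite A" "x \<noteq> i"
  shows "card {f \<in> A. x \<notin> f} \<le> card {f \<in> shift i j A. x \<notin> f}"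
proof -
  have fin: "finite (shift i j A)" using assms unfolding shift_def by auto
  have "{f \<in> A. x \<in> f \<or> (j \<in> f \<and> i \<notin> f \<and> x \<in> insert i (f - {j}))} = {f \<in> A. x \<in> f}"
    using assms(2) by auto
  then have "card {f \<in> shift i j A. x \<in> f} \<le> card {f \<in> A. x \<in> f}"
    using card_shift_Collect_le[OF assms(1), of i j "\<lambda>f. x \<in> f"] by simp
  then show ?thesis
    using card_split_member[OF assms(1), of x] card_split_member[OF fin, of x] card_shift[of i j A]
    by linarith
qed

lemma sum_shift_set_le:
  assumes "i < j" "finite f"
  shows "\<Sum>(shift_set i j A f) \<le> \<Sum>f"
    and "shift_set i j A f \<noteq> f \<Longrightarrow> \<Sum>(shift_set i j A f) < \<Sum>f"
proof -
  have "\<Sum>(insert i (f - {j})) < \<Sum>f" if "j \<in> f" "i \<notin> f"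
  proof -
    have "\<Sum>(insert i (f - {j})) = i + \<Sum>(f - {j})" using that assms by simp
    also have "\<dots> < j + \<Sum>(f - {j})" using assms by simp
    also have "\<dots> = \<Sum>f" using that assms by (simp add: sum.remove)
    finally show ?thesis .
  qed
  then show "\<Sum>(shift_set i j A f) \<le> \<Sum>f"
    and "shift_set i j A f \<noteq> f \<Longrightarrow> \<Sum>(shift_set i j A f) < \<Sum>f"
    unfolding shift_set_def by (auto simp: less_imp_le split: if_splits)
qed

text \<open>Termination measure for repeated shifting: it drops strictly as soon as one member
  moves.\<close>

definition weight :: "nat set set \<Rightarrow> nat" where
  "weight A = (\<Sum>a\<in>A. \<Sum>a)"

lemma weight_shift:
  assumes "i < j" "finite A" "\<And>a. a \<in> A \<Longrightarrow> finite a"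
  shows "weight (shift i j A) \<le> weight A"
    and "f \<in> A \<Longrightarrow> shift_set i j A f \<noteq> f \<Longrightarrow> weight (shift i j A) < weight A"
proof -
  have eq: "weight (shift i j A) = (\<Sum>a\<in>A. \<Sum>(shift_set i j A a))"
    unfolding weight_def shift_def by (rule sum.reindex_cong[OF inj_on_shift_set refl]) simp
  show "weight (shift i j A) \<le> weight A"
    unfolding eq unfolding weight_def using assms by (intro sum_mono sum_shift_set_le)
  show "weight (shift i j A) < weight A" if "f \<in> A" "shift_set i j A f \<noteq> f"
    unfolding eq unfolding weight_def
    using assms that by (intro sum_strict_mono_ex1) (auto intro: sum_shift_set_le)
qed

lemma finite_nsets_subset:
  assumes "finite X" "A \<subseteq> nsets X a"
  shows "finite A" and "\<And>f. f \<in> A \<Longrightarrow> finite f"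
proof -
  have "nsets X a \<subseteq> Pow X" by (auto simp: nsets_def)
  then show "finite A" using assms by (meson finite_Pow_iff finite_subset subset_trans)
  show "\<And>f. f \<in> A \<Longrightarrow> finite f" using assms by (auto simp: nsets_def)
qed

text \<open>A property of cross-intersecting pairs need only be checked for shifted pairs and pulled
  back through a single shift. Both families undergo the same shift, as this preserves
  cross-intersection.\<close>

lemma shift_induct [consumes 4, case_names base step]:
  assumes "finite X" and "A \<subseteq> nsets X a" and "B \<subseteq> nsets X b" and "cross_intersecting A B"
    and base: "\<And>A B. A \<subseteq> nsets X a \<Longrightarrow> B \<subseteq> nsets X b \<Longrightarrow> cross_intersecting A B \<Longrightarrow>
      shifted X A \<Longrightarrow> shifted X B \<Longrightarrow> R A B"
    and step: "\<And>A B i j. A \<subseteq> nsets X a \<Longrightarrow> B \<subseteq> nsets X b \<Longrightarrow> cross_intersecting A B \<Longrightarrow>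
      i \<in> X \<Longrightarrow> j \<in> X \<Longrightarrow> i < j \<Longrightarrow> R (shift i j A) (shift i j B) \<Longrightarrow> R A B"
  shows "R A B"
  using assms(2-4)
proof (induction "weight A + weight B" arbitrary: A B rule: less_induct)
  case less
  note fin = finite_nsets_subset[OF assms(1) less.prems(1)]
    finite_nsets_subset[OF assms(1) less.prems(2)]
  show ?case
  proof (cases "shifted X A \<and> shifted X B")
    case True
    then show ?thesis using base less.prems by blast
  next
    case False
    then obtain i j f where ij: "i \<in> X" "j \<in> X" "i < j"
      and f: "(f \<in> A \<and> shift_set i j A f \<noteq> f) \<or> (f \<in> B \<and> shift_set i j B f \<noteq> f)"
      using not_shiftedE by metis
    have "weight (shift i j A) + weight (shift i j B) < weight A + weight B"
      using f weight_shift[OF ij(3) fin(1,2)] weight_shift[OF ij(3) fin(3,4)]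
      by (meson add_le_less_mono add_less_le_mono)
    from less.hyps[OF this shift_subset_nsets[OF less.prems(1) ij(1)]
        shift_subset_nsets[OF less.prems(2) ij(1)] cross_intersecting_shift[OF less.prems(3)]]
    show ?thesis using step[OF less.prems ij] by blast
  qed
qed

text \<open>The least common element of two members can be shifted away in the first one without
  disturbing the prefix counts: before that element the two members are disjoint.\<close>

lemma shifted_cross_intersecting_prefix:
  assumes "finite X" "shifted X A" "cross_intersecting A B" "a \<in> A" "b \<in> B" "a \<subseteq> X" "b \<subseteq> X"
  shows "\<exists>v\<in>X. card (X \<inter> {..v}) < card (a \<inter> {..v}) + card (b \<inter> {..v})"
  using assms(4,6)
proof (induction "card (a \<inter> b)" arbitrary: a rule: less_induct)
  case less
  have fin: "finite a" "finite b" using less.prems assms finite_subset by blast+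
  have ne: "a \<inter> b \<noteq> {}" using assms less.prems unfolding cross_intersecting_def by blast
  define v where "v = Min (a \<inter> b)"
  have v: "v \<in> a" "v \<in> b" "\<And>x. x \<in> a \<inter> b \<Longrightarrow> v \<le> x"
    using Min_in[of "a \<inter> b"] Min_le[of "a \<inter> b"] ne fin unfolding v_def by auto
  have vX: "v \<in> X" using v less.prems by auto
  show ?case
  proof (rule ccontr)
    assume c: "\<not> ?thesis"
    then have le: "card (a \<inter> {..w}) + card (b \<inter> {..w}) \<le> card (X \<inter> {..w})" if "w \<in> X" for w
      using that by (meson not_less)
    \<comment> \<open>If all elements of \<open>X\<close> below \<open>v\<close> lay in
      \<open>a\<close> or \<open>b\<close>, then \<open>v\<close>, counted in both, would itself be
      a witness.\<close>
    have "\<exists>i. i \<in> X \<and> i < v \<and> i \<notin> a \<and> i \<notin> b"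
    proof (rule ccontr)
      assume "\<not> ?thesis"
      then have "X \<inter> {..v} \<subseteq> (a \<inter> {..v}) \<union> ((b \<inter> {..v}) - {v})"
        using v by (auto simp: le_less)
      then have "card (X \<inter> {..v}) \<le> card ((a \<inter> {..v}) \<union> ((b \<inter> {..v}) - {v}))"
        using fin by (intro card_mono) auto
      also have "\<dots> \<le> card (a \<inter> {..v}) + card ((b \<inter> {..v}) - {v})" by (rule card_Un_le)
      also have "card ((b \<inter> {..v}) - {v}) < card (b \<inter> {..v})"
        using v fin by (intro psubset_card_mono) auto
      finally show False using le[OF vX] by simp
    qed
    then obtain i where i: "i \<in> X" "i < v" "i \<notin> a" "i \<notin> b" by blast
    define a' where "a' = insert i (a - {v})"
    have a': "a' \<in> A" "a' \<subseteq> X"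
      using assms(2) i v vX less.prems unfolding shifted_def a'_def by auto
    have "card (a' \<inter> b) < card (a \<inter> b)"
      using fin v i unfolding a'_def by (intro psubset_card_mono) auto
    from less.hyps[OF this a'] obtain w where w: "w \<in> X"
      "card (X \<inter> {..w}) < card (a' \<inter> {..w}) + card (b \<inter> {..w})" by blast
    \<comment> \<open>From \<open>v\<close> on, the prefix counts of \<open>a'\<close> and
      \<open>a\<close> agree; before \<open>v\<close>, \<open>a'\<close> is disjoint from
      \<open>b\<close>, so no witness lies there.\<close>
    show False
    proof (cases "v \<le> w")
      case True
      then have "a' \<inter> {..w} = insert i ((a \<inter> {..w}) - {v})" using i unfolding a'_def by auto
      moreover have "card (insert i ((a \<inter> {..w}) - {v})) = card (a \<inter> {..w})"
        using True v i fin by (metis Diff_iff IntD1 IntI atMost_iff card_Suc_Diff1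
            card_insert_disjoint finite_Diff finite_Int)
      ultimately show False using w le[OF w(1)] by simp
    next
      case False
      then have "(a' \<inter> {..w}) \<inter> (b \<inter> {..w}) = {}" using v(3) i unfolding a'_def by fastforce
      then have "card (a' \<inter> {..w}) + card (b \<inter> {..w}) = card ((a' \<inter> {..w}) \<union> (b \<inter> {..w}))"
        using fin by (intro card_Un_disjoint[symmetric]) (auto simp: a'_def)
      also have "\<dots> \<le> card (X \<inter> {..w})"
        using a' assms by (intro card_mono) auto
      finally show False using w by simp
    qed
  qed
qed

section \<open>Initial segments of a finite set of naturals\<close>

text \<open>The first \<open>t\<close> elements of \<open>X\<close> in increasing order, described
  by rank because \<open>X\<close> may have gaps.\<close>

definition prefix :: "nat set \<Rightarrow> nat \<Rightarrow> nat set" where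
  "prefix X t = {x \<in> X. card (X \<inter> {..x}) \<le> t}"

lemma prefix_subset: "prefix X t \<subseteq> X"
  unfolding prefix_def by auto

lemma prefix_mono: "s \<le> t \<Longrightarrow> prefix X s \<subseteq> prefix X t"
  unfolding prefix_def by auto

lemma card_Int_atMost_less:
  fixes X :: "nat set"
  assumes "finite X" "y \<in> X" "x < y"
  shows "card (X \<inter> {..x}) < card (X \<inter> {..y})"
proof (rule psubset_card_mono)
  have "y \<in> X \<inter> {..y}" "y \<notin> X \<inter> {..x}" using assms by auto
  moreover have "X \<inter> {..x} \<subseteq> X \<inter> {..y}" using assms by auto
  ultimately show "X \<inter> {..x} \<subset> X \<inter> {..y}" by blast
qed (use assms in simp)

lemma prefix_card_eq:
  assumes "finite X" "v \<in> X"
  shows "X \<inter> {..v} = prefix X (card (X \<inter> {..v}))"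
proof -
  have "card (X \<inter> {..v}) < card (X \<inter> {..x})" if "x \<in> X" "v < x" for x
    using that assms card_Int_atMost_less by blast
  moreover have "card (X \<inter> {..x}) \<le> card (X \<inter> {..v})" if "x \<le> v" for x
    using that assms by (intro card_mono) auto
  ultimately show ?thesis unfolding prefix_def by (auto simp: not_le[symmetric])
qed

lemma card_prefix:
  assumes "finite X"
  shows "card (prefix X t) = min t (card X)"
proof -
  let ?r = "\<lambda>x. card (X \<inter> {..x})"
  have lt: "?r x < ?r y" if "x < y" "y \<in> X" for x y
    using that assms card_Int_atMost_less by blast
  have inj: "inj_on ?r X"
    by (rule inj_onI) (metis lt linorder_neqE_nat less_irrefl)
  have sub: "?r ` X \<subseteq> {1..card X}"
  proof
    fix y assume "y \<in> ?r ` X"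
    then obtain x where x: "x \<in> X" "y = ?r x" by auto
    have "y \<le> card X" using x assms by (auto intro: card_mono)
    moreover have "X \<inter> {..x} \<noteq> {}" using x by auto
    then have "y > 0" using x assms by (simp add: card_gt_0_iff)
    ultimately show "y \<in> {1..card X}" by auto
  qed
  have eq: "?r ` X = {1..card X}"
    using sub card_image[OF inj] by (intro card_subset_eq) auto
  have "?r ` prefix X t = {1..min t (card X)}"
  proof -
    have "?r ` prefix X t = ?r ` X \<inter> {..t}" unfolding prefix_def by auto
    then show ?thesis unfolding eq by auto
  qed
  moreover have "card (?r ` prefix X t) = card (prefix X t)"
    using inj prefix_subset by (meson card_image inj_on_subset)
  ultimately show ?thesis by simp
qed

lemma card_prefix_diff:
  assumes "finite X" "s \<le> t"
  shows "card (prefix X t - prefix X s) \<le> t - s"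
proof -
  have "finite (prefix X s)" using assms prefix_subset finite_subset by blast
  then have "card (prefix X t - prefix X s) = card (prefix X t) - card (prefix X s)"
    using prefix_mono[OF assms(2)] by (rule card_Diff_subset)
  then show ?thesis using assms by (auto simp: card_prefix min_def)
qed

subsection \<open>Counting sets with a large intersection\<close>

text \<open>\<open>D j\<close> is the number of \<open>k\<close>-sets containing \<open>j\<close> fixed elements of an \<open>n\<close>-set, with value 0 for
  \<open>j > k\<close>. Links of \<open>u\<close>-sets are \<open>(k - u)\<close>-uniform on at most \<open>n - u\<close> points; \<open>u\<close> is carried along so
  that all bounds are in terms of the same \<open>n\<close> and \<open>k\<close>.\<close>

locale sparse_uniform =
  fixes n k :: nat
  assumes nk: "24 * k \<le> n"
begin

definition D :: "nat \<Rightarrow> real" where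
  "D j = (if j \<le> k then real ((n - j) choose (k - j)) else 0)"

lemma D_nonneg: "0 \<le> D j"
  unfolding D_def by simp

lemma D_Suc_eq:
  assumes "Suc j \<le> k"
  shows "real (n - j) * D (Suc j) = real (k - j) * D j"
proof -
  have "j < n" using assms nk by simp
  then have *: "n - j = Suc (n - Suc j)" "k - j = Suc (k - Suc j)" using assms by auto
  have "(n - j) * ((n - Suc j) choose (k - Suc j)) = ((n - j) choose (k - j)) * (k - j)"
    using Suc_times_binomial_eq[of "n - Suc j" "k - Suc j"] unfolding * by simp
  then have "real (n - j) * real ((n - Suc j) choose (k - Suc j))
    = real (k - j) * real ((n - j) choose (k - j))"
    by (metis mult.commute of_nat_mult)
  then show ?thesis using assms unfolding D_def by simp
qed

text \<open>For \<open>j < k\<close> the ratio of consecutive values is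
  \<open>(k - j) / (n - j)\<close>, which is at most \<open>k / n\<close>.\<close>

lemma D_Suc: "D (Suc j) \<le> D j / 24"
proof (cases "Suc j \<le> k")
  case True
  have pos: "0 < real (n - j)" using True nk by simp
  have "24 * real (k - j) \<le> real (n - j)" using True nk by (simp add: of_nat_diff)
  then have "24 * (real (n - j) * D (Suc j)) \<le> real (n - j) * D j"
    unfolding D_Suc_eq[OF True] using mult_right_mono[OF _ D_nonneg] by (metis mult.assoc)
  then have "real (n - j) * (24 * D (Suc j)) \<le> real (n - j) * D j" by (simp add: mult.left_commute)
  then show ?thesis using mult_le_cancel_left_pos[OF pos] by simp
qed (use D_nonneg[of j] in \<open>simp add: D_def\<close>)

lemma D_add: "D (j + w) \<le> D j / 24 ^ w"
proof (induction w)
  case (Suc w)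
  have "D (j + Suc w) \<le> D (j + w) / 24" using D_Suc[of "j + w"] by simp
  also have "\<dots> \<le> (D j / 24 ^ w) / 24" using Suc by (intro divide_right_mono) auto
  finally show ?case by simp
qed simp

lemma D4_le: "D 4 \<le> D 3 / 24"
  using D_Suc[of 3] by simp

text \<open>Removing \<open>Q\<close> injects these sets into the
  \<open>(a - card Q)\<close>-subsets of \<open>X - Q\<close>, a set of at most
  \<open>n - (u + card Q)\<close> points.\<close>

lemma card_supersets:
  assumes "finite X" "Q \<subseteq> X" "a + u = k" "card X + u \<le> n"
  shows "real (card {f \<in> nsets X a. Q \<subseteq> f}) \<le> D (u + card Q)"
proof -
  have finQ: "finite Q" using assms finite_subset by blast
  show ?thesis
  proof (cases "card Q \<le> a")
    case False
    have "\<not> Q \<subseteq> f" if "f \<in> nsets X a" for f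
      using that False card_mono[of f Q] by (auto simp: nsets_def)
    then have "{f \<in> nsets X a. Q \<subseteq> f} = {}" by blast
    then have "card {f \<in> nsets X a. Q \<subseteq> f} = 0" by (simp only: card.empty)
    then show ?thesis using D_nonneg by simp
  next
    case True
    have "card {f \<in> nsets X a. Q \<subseteq> f} \<le> card (nsets (X - Q) (a - card Q))"
    proof (rule card_inj_on_le[of "\<lambda>f. f - Q"])
      show "inj_on (\<lambda>f. f - Q) {f \<in> nsets X a. Q \<subseteq> f}"
        by (rule inj_on_inverseI[of _ "\<lambda>f. Q \<union> f"]) auto
      show "(\<lambda>f. f - Q) ` {f \<in> nsets X a. Q \<subseteq> f} \<subseteq> nsets (X - Q) (a - card Q)"
        using finQ by (auto simp: nsets_def card_Diff_subset)
      show "finite (nsets (X - Q) (a - card Q))"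
        using assms by (simp add: finite_imp_finite_nsets)
    qed
    also have "\<dots> = (card X - card Q) choose (a - card Q)"
      using assms finQ by (simp add: card_nsets card_Diff_subset)
    also have "\<dots> \<le> (n - (u + card Q)) choose (k - (u + card Q))"
    proof -
      have "a - card Q = k - (u + card Q)" using assms by simp
      then show ?thesis using assms by (simp add: binomial_right_mono)
    qed
    finally show ?thesis using True assms unfolding D_def by simp
  qed
qed

lemma card_large_intersection:
  assumes "finite X" "P \<subseteq> X" "card P \<le> t" "a + u = k" "card X + u \<le> n"
  shows "real (card {f \<in> nsets X a. q \<le> card (f \<inter> P)}) \<le> real (t choose q) * D (u + q)"
proof -
  have finP: "finite P" using assms finite_subset by blast
  have sub: "{f \<in> nsets X a. q \<le> card (f \<inter> P)} \<subseteq> (\<Union>Q\<in>nsets P q. {f \<in> nsets X a. Q \<subseteq> f})"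
  proof
    fix f assume f: "f \<in> {f \<in> nsets X a. q \<le> card (f \<inter> P)}"
    then obtain Q where "Q \<subseteq> f \<inter> P" "card Q = q" "finite Q"
      using obtain_subset_with_card_n[of q "f \<inter> P"] by auto
    then have "Q \<in> nsets P q" "Q \<subseteq> f" by (auto simp: nsets_def)
    then show "f \<in> (\<Union>Q\<in>nsets P q. {f \<in> nsets X a. Q \<subseteq> f})" using f by auto
  qed
  have finN: "finite (nsets P q)" using finP by (simp add: finite_imp_finite_nsets)
  have fin: "finite (nsets X a)" using assms by (simp add: finite_imp_finite_nsets)
  have "card {f \<in> nsets X a. q \<le> card (f \<inter> P)} \<le> card (\<Union>Q\<in>nsets P q. {f \<in> nsets X a. Q \<subseteq> f})"
    using finN fin by (intro card_mono[OF _ sub]) auto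
  also have "\<dots> \<le> (\<Sum>Q\<in>nsets P q. card {f \<in> nsets X a. Q \<subseteq> f})"
    by (rule card_UN_le[OF finN])
  finally have "real (card {f \<in> nsets X a. q \<le> card (f \<inter> P)})
    \<le> (\<Sum>Q\<in>nsets P q. real (card {f \<in> nsets X a. Q \<subseteq> f}))"
    by (simp only: of_nat_le_iff flip: of_nat_sum)
  also have "\<dots> \<le> (\<Sum>Q\<in>nsets P q. D (u + q))"
  proof (rule sum_mono)
    fix Q assume "Q \<in> nsets P q"
    then have "Q \<subseteq> X" "card Q = q" using assms by (auto simp: nsets_def)
    then show "real (card {f \<in> nsets X a. Q \<subseteq> f}) \<le> D (u + q)"
      using card_supersets[OF assms(1) _ assms(4,5)] by blast
  qed
  also have "\<dots> = real (card P choose q) * D (u + q)" by (simp add: card_nsets)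
  also have "\<dots> \<le> real (t choose q) * D (u + q)"
    using assms(3) D_nonneg by (intro mult_right_mono) (auto simp: binomial_right_mono)
  finally show ?thesis .
qed

text \<open>Raising \<open>w\<close> by one multiplies the binomial coefficient by at most
  \<open>r\<close> and divides the bound for \<open>D\<close> by 24. The union bound is thus a
  geometric series of ratio \<open>r / 24\<close>, with sum at most
  \<open>24 / (24 - r)\<close>.\<close>

lemma card_large_intersection_seq:
  assumes "finite X" "\<And>w. P w \<subseteq> X" "\<And>w. card (P w) \<le> t w" "a + u = k" "card X + u \<le> n"
    and r: "0 \<le> r" "r < 24"
    and ratio: "\<And>w. real (t (Suc w) choose (q + Suc w)) \<le> r * real (t w choose (q + w))"
  shows "real (card {f \<in> nsets X a. \<exists>w. q + w \<le> card (f \<inter> P w)})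
    \<le> 24 / (24 - r) * real (t 0 choose q) * D (u + q)"
proof -
  have finN: "finite (nsets X a)" using assms by (simp add: finite_imp_finite_nsets)
  let ?S = "\<lambda>w. {f \<in> nsets X a. q + w \<le> card (f \<inter> P w)}"
  have sub: "{f \<in> nsets X a. \<exists>w. q + w \<le> card (f \<inter> P w)} \<subseteq> (\<Union>w<Suc a. ?S w)"
  proof
    fix f assume "f \<in> {f \<in> nsets X a. \<exists>w. q + w \<le> card (f \<inter> P w)}"
    then obtain w where f: "f \<in> nsets X a" and w: "q + w \<le> card (f \<inter> P w)" by auto
    have "card (f \<inter> P w) \<le> a" using f card_mono[of f "f \<inter> P w"] by (auto simp: nsets_def)
    then show "f \<in> (\<Union>w<Suc a. ?S w)" using f w by auto
  qed
  have coeff: "real (t w choose (q + w)) \<le> real (t 0 choose q) * r ^ w" for w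
  proof (induction w)
    case (Suc w)
    have "real (t (Suc w) choose (q + Suc w)) \<le> r * (real (t 0 choose q) * r ^ w)"
      using ratio[of w] mult_left_mono[OF Suc r(1)] by linarith
    then show ?case by (simp add: mult_ac)
  qed simp
  have "card {f \<in> nsets X a. \<exists>w. q + w \<le> card (f \<inter> P w)} \<le> card (\<Union>w<Suc a. ?S w)"
    using finN by (intro card_mono[OF _ sub]) auto
  also have "\<dots> \<le> (\<Sum>w<Suc a. card (?S w))" by (rule card_UN_le) simp
  finally have "real (card {f \<in> nsets X a. \<exists>w. q + w \<le> card (f \<inter> P w)})
    \<le> (\<Sum>w<Suc a. real (card (?S w)))"
    by (simp only: of_nat_le_iff flip: of_nat_sum)
  also have "\<dots> \<le> (\<Sum>w<Suc a. real (t 0 choose q) * D (u + q) * (r / 24) ^ w)"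
  proof (rule sum_mono)
    fix w
    have "real (card (?S w)) \<le> real (t w choose (q + w)) * D (u + q + w)"
      using card_large_intersection[OF assms(1) assms(2,3)[of w] assms(4,5), of "q + w"] by (simp add: add.assoc)
    also have "\<dots> \<le> (real (t 0 choose q) * r ^ w) * (D (u + q) / 24 ^ w)"
      by (rule mult_mono[OF coeff D_add _ D_nonneg]) (simp add: r)
    finally show "real (card (?S w)) \<le> real (t 0 choose q) * D (u + q) * (r / 24) ^ w"
      by (simp add: power_divide mult_ac)
  qed
  also have "\<dots> = real (t 0 choose q) * D (u + q) * (\<Sum>w<Suc a. (r / 24) ^ w)"
    by (simp only: sum_distrib_left)
  also have "\<dots> \<le> real (t 0 choose q) * D (u + q) * (24 / (24 - r))"
  proof (rule mult_left_mono)
    have "(\<Sum>w<Suc a. (r / 24) ^ w) = (1 - (r / 24) ^ Suc a) / (1 - r / 24)"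
      using r by (subst sum_gp_strict) auto
    also have "\<dots> \<le> 1 / (1 - r / 24)" using r by (intro divide_right_mono) auto
    also have "\<dots> = 24 / (24 - r)" using r by (simp add: field_simps)
    finally show "(\<Sum>w<Suc a. (r / 24) ^ w) \<le> 24 / (24 - r)" .
  qed (use D_nonneg in simp)
  finally show ?thesis by (simp add: mult_ac)
qed

end

section \<open>Growth of binomial coefficients parallel to the diagonal\<close>

text \<open>The quotient of the two coefficients with denominators cleared; it follows from two
  absorption identities and symmetry.\<close>

lemma binomial_diagonal_step:
  "(q + e + 2) * (q + e + 1) * ((q + e) choose q) = (q + 1) * (e + 1) * ((q + e + 2) choose (q + 1))"
proof -
  have 1: "Suc q * (Suc (Suc (q + e)) choose Suc q) = Suc (Suc (q + e)) * (Suc (q + e) choose q)"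
    by (rule Suc_times_binomial)
  have "Suc e * (Suc (q + e) choose Suc e) = Suc (q + e) * ((q + e) choose e)"
    by (rule Suc_times_binomial)
  moreover have "Suc (q + e) choose Suc e = Suc (q + e) choose q"
    using binomial_symmetric[of q "Suc (q + e)"] by simp
  moreover have "(q + e) choose e = (q + e) choose q"
    using binomial_symmetric[of q "q + e"] by simp
  ultimately have 2: "Suc e * (Suc (q + e) choose q) = Suc (q + e) * ((q + e) choose q)" by simp
  have "(q + e + 2) * (q + e + 1) * ((q + e) choose q)
      = Suc (Suc (q + e)) * (Suc (q + e) * ((q + e) choose q))"
    by (simp only: mult.assoc add_2_eq_Suc' Suc_eq_plus1[symmetric])
  also have "\<dots> = Suc e * (Suc (Suc (q + e)) * (Suc (q + e) choose q))"
    unfolding 2[symmetric] by (rule mult.left_commute)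
  also have "\<dots> = Suc e * (Suc q * (Suc (Suc (q + e)) choose Suc q))" unfolding 1 ..
  finally show ?thesis by (simp only: mult.assoc mult.left_commute[of "Suc e"] add_2_eq_Suc' Suc_eq_plus1[symmetric])
qed

lemma binomial_diagonal_ratio:
  assumes "(q + e + 2) * (q + e + 1) \<le> r * ((q + 1) * (e + 1))"
  shows "real ((q + e + 2) choose (q + 1)) \<le> real r * real ((q + e) choose q)"
proof -
  have "((q + 1) * (e + 1)) * ((q + e + 2) choose (q + 1)) \<le> ((q + 1) * (e + 1)) * (r * ((q + e) choose q))"
    using mult_right_mono[OF assms, of "(q + e) choose q"]
    unfolding binomial_diagonal_step by (simp only: mult_ac)
  then have "((q + e + 2) choose (q + 1)) \<le> r * ((q + e) choose q)"
    using mult_le_cancel1 by (metis add_gr_0 nat_0_less_mult_iff zero_less_one)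
  then show ?thesis by (metis of_nat_le_iff of_nat_mult)
qed

text \<open>The true ratio is \<open>s + 3\<close> at \<open>w = 0\<close> and tends to 4;
  \<open>s + 4\<close> bounds it for every \<open>w\<close>.\<close>

lemma binomial_ratio_near_diagonal:
  "real ((s + 1 + 2 * Suc w) choose (s + 1 + Suc w)) \<le> real (s + 4) * real ((s + 1 + 2 * w) choose (s + 1 + w))"
proof -
  have "((s + 1 + w) + w + 2) * ((s + 1 + w) + w + 1) \<le> (s + 4) * (((s + 1 + w) + 1) * (w + 1))"
    by (simp add: algebra_simps)
  note binomial_diagonal_ratio[OF this]
  moreover have "s + 1 + 2 * Suc w = (s + 1 + w) + w + 2" "s + 1 + Suc w = (s + 1 + w) + 1"
    "s + 1 + 2 * w = (s + 1 + w) + w" by simp_all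
  ultimately show ?thesis by (simp only:)
qed

lemma binomial_ratio_5_3:
  "real ((5 + 2 * Suc w) choose (3 + Suc w)) \<le> 4 * real ((5 + 2 * w) choose (3 + w))"
proof -
  have "((3 + w) + (2 + w) + 2) * ((3 + w) + (2 + w) + 1) \<le> 4 * (((3 + w) + 1) * ((2 + w) + 1))"
    by (simp add: algebra_simps)
  from binomial_diagonal_ratio[OF this] show ?thesis
    by (simp add: algebra_simps mult_2)
qed

subsection \<open>Size gaps for cross-intersecting families\<close>

text \<open>In some prefix \<open>a\<close> and \<open>b\<close> together have more points than its
  length \<open>t\<close>. Lightness caps the share of \<open>a\<close> at about
  \<open>(t - s) / 2\<close>, so \<open>b\<close> must supply the rest.\<close>

lemma shifted_cross_intersecting_heavy:
  assumes "finite X" "shifted X A" "cross_intersecting A B" "a \<in> A" "b \<in> B" "a \<subseteq> X" "b \<subseteq> X"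
    and light: "\<And>w. card (a \<inter> prefix X (s + 2 * w)) \<le> w"
  shows "\<exists>w. s + 1 + w \<le> card (b \<inter> prefix X (s + 1 + 2 * w))"
proof -
  have fin: "finite a" "finite b" using assms finite_subset by blast+
  obtain v where v: "v \<in> X" "card (X \<inter> {..v}) < card (a \<inter> {..v}) + card (b \<inter> {..v})"
    using shifted_cross_intersecting_prefix[OF assms(1-7)] by blast
  define t where "t = card (X \<inter> {..v})"
  have eq: "X \<inter> {..v} = prefix X t" using prefix_card_eq[OF assms(1) v(1)] unfolding t_def .
  have "a \<inter> {..v} = a \<inter> prefix X t" "b \<inter> {..v} = b \<inter> prefix X t"
    using assms(6,7) eq by auto
  then have t: "t < card (a \<inter> prefix X t) + card (b \<inter> prefix X t)" using v(2) t_def by simp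
  have mono: "card (a \<inter> prefix X t1) \<le> card (a \<inter> prefix X t2)" if "t1 \<le> t2" for t1 t2
    using fin prefix_mono[OF that] by (intro card_mono) auto
  have "card (b \<inter> prefix X t) \<le> t"
    using card_mono[of "prefix X t" "b \<inter> prefix X t"] card_prefix[OF assms(1), of t]
      finite_subset[OF prefix_subset assms(1)] by auto
  then have "0 < card (a \<inter> prefix X t)" using t by simp
  \<comment> \<open>\<open>light[of 0]\<close> says that \<open>a\<close> misses the first
    \<open>s\<close> elements, yet it meets the prefix of length \<open>t\<close>.\<close>
  then have "s < t" using light[of 0] mono[of t s] by (metis add.right_neutral mult_0_right
        not_le le_trans le_zero_eq less_irrefl)
  then obtain w where "t = s + 1 + 2 * w \<or> t = s + 2 + 2 * w"
  proof -
    have "t = s + 1 + 2 * ((t - s - 1) div 2) \<or> t = s + 2 + 2 * ((t - s - 1) div 2)"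
      using \<open>s < t\<close> by presburger
    then show ?thesis using that by blast
  qed
  then show ?thesis
  proof
    assume w: "t = s + 1 + 2 * w"
    then have "card (a \<inter> prefix X t) \<le> w + 1" using mono[of t "s + 2 * (w + 1)"] light[of "w + 1"] by simp
    then have "s + 1 + w \<le> card (b \<inter> prefix X (s + 1 + 2 * w))" using t w by simp
    then show ?thesis by blast
  next
    \<comment> \<open>Here the prefix is one element too long, but the count for \<open>b\<close> is
      one larger too, which pays for dropping the last element.\<close>
    assume w: "t = s + 2 + 2 * w"
    then have "card (a \<inter> prefix X t) \<le> w + 1" using light[of "w + 1"] by simp
    then have "s + 2 + w \<le> card (b \<inter> prefix X t)" using t w by simp
    also have "\<dots> \<le> card ((b \<inter> prefix X (s + 1 + 2 * w)) \<union> (prefix X t - prefix X (s + 1 + 2 * w)))"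
      using fin finite_subset[OF prefix_subset assms(1)] by (intro card_mono) auto
    also have "\<dots> \<le> card (b \<inter> prefix X (s + 1 + 2 * w)) + card (prefix X t - prefix X (s + 1 + 2 * w))"
      by (rule card_Un_le)
    also have "card (prefix X t - prefix X (s + 1 + 2 * w)) \<le> 1"
      using card_prefix_diff[OF assms(1), of "s + 1 + 2 * w" t] w by simp
    finally have "s + 1 + w \<le> card (b \<inter> prefix X (s + 1 + 2 * w))" by simp
    then show ?thesis by blast
  qed
qed

section \<open>Traces on a fixed set and their residues\<close>

definition trace :: "'a set set \<Rightarrow> 'a set \<Rightarrow> 'a set \<Rightarrow> 'a set set" where
  "trace F Z S = {f \<in> F. f \<inter> Z = S}"

text \<open>Removing \<open>Z\<close> turns a trace into a uniform family of the same size on the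
  remaining points, to which the cross-intersecting bounds apply again.\<close>

definition residue :: "'a set set \<Rightarrow> 'a set \<Rightarrow> 'a set \<Rightarrow> 'a set set" where
  "residue F Z S = (\<lambda>f. f - Z) ` trace F Z S"

lemma card_residue: "card (residue F Z S) = card (trace F Z S)"
  unfolding residue_def
proof (rule card_image)
  show "inj_on (\<lambda>f. f - Z) (trace F Z S)"
    by (rule inj_on_inverseI[of _ "\<lambda>f. f \<union> S"]) (auto simp: trace_def)
qed

lemma residue_subset_nsets:
  assumes "F \<subseteq> nsets X a"
  shows "residue F Z S \<subseteq> nsets (X - Z) (a - card S)"
proof
  fix g assume "g \<in> residue F Z S"
  then obtain f where f: "f \<in> F" "f \<inter> Z = S" "g = f - Z" by (auto simp: residue_def trace_def)
  then have "f \<subseteq> X" "finite f" "card f = a" using assms by (auto simp: nsets_def)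
  moreover have "card (f - Z) = card f - card (f \<inter> Z)"
    using \<open>finite f\<close> by (metis card_Diff_subset_Int finite_Int)
  ultimately show "g \<in> nsets (X - Z) (a - card S)" using f by (auto simp: nsets_def)
qed

lemma card_le_if_trace_nonempty:
  assumes "F \<subseteq> nsets X a" "trace F Z S \<noteq> {}"
  shows "card S \<le> a"
proof -
  obtain f where "f \<in> F" "f \<inter> Z = S" using assms(2) by (auto simp: trace_def)
  then show ?thesis using assms(1) card_mono[of f "f \<inter> Z"] by (auto simp: nsets_def)
qed

lemma cross_intersecting_residue:
  assumes "cross_intersecting A B" "S \<inter> T = {}"
  shows "cross_intersecting (residue A Z S) (residue B Z T)"
  unfolding cross_intersecting_def
proof (intro ballI)
  fix f g assume "f \<in> residue A Z S" "g \<in> residue B Z T"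
  then obtain a b where ab: "a \<in> A" "a \<inter> Z = S" "f = a - Z" "b \<in> B" "b \<inter> Z = T" "g = b - Z"
    by (auto simp: residue_def trace_def)
  then have "a \<inter> b \<noteq> {}" using assms(1) unfolding cross_intersecting_def by blast
  then show "f \<inter> g \<noteq> {}" using ab assms(2) by auto
qed

context sparse_uniform
begin

text \<open>At most \<open>s * \<tau>\<close> members of \<open>A\<close> meet the first
  \<open>s\<close> elements, and few have \<open>2 + w\<close> of the next \<open>2 + 2 * w\<close>
  for some \<open>w\<close>. A member escaping both is light, so every member of \<open>B\<close> is
  heavy on some prefix, and such sets are counted by a geometric series.\<close>

lemma shifted_cross_intersecting_card_le:
  assumes "finite X" "A \<subseteq> nsets X a" "B \<subseteq> nsets X b" "cross_intersecting A B" "shifted X A"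
    and u: "a + u = k" "card X + u \<le> n" and u': "b + u' = k" "card X + u' \<le> n"
    and deg: "\<And>x. x \<in> X \<Longrightarrow> real (card {f \<in> A. x \<in> f}) \<le> \<tau>"
    and "0 \<le> \<tau>" and "s < 20"
    and large: "real s * \<tau> + 24 / 19 * D (u + 2) < real (card A)"
  shows "real (card B) \<le> 24 / (20 - real s) * D (u' + (s + 1))"
proof -
  note finA = finite_nsets_subset[OF assms(1,2)]
  have finN: "finite (nsets X a)" "finite (nsets X b)"
    using assms(1) by (auto simp: finite_imp_finite_nsets)
  let ?P = "prefix X s"
  have finP: "finite ?P" using finite_subset[OF prefix_subset assms(1)] .
  let ?W = "{f \<in> nsets X a. \<exists>w. 2 + w \<le> card (f \<inter> (prefix X (s + 2 + 2 * w) - ?P))}"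
  \<comment> \<open>The leading coefficient is \<open>2 choose 2 = 1\<close> and the ratio is 5,
    whence the factor \<open>24 / (24 - 5)\<close>.\<close>
  have W: "real (card ?W) \<le> 24 / 19 * D (u + 2)"
  proof -
    have "card (prefix X (s + 2 + 2 * w) - ?P) \<le> 1 + 1 + 2 * w" for w
      using card_prefix_diff[OF assms(1), of s "s + 2 + 2 * w"] by simp
    moreover have "prefix X (s + 2 + 2 * w) - ?P \<subseteq> X" for w using prefix_subset by blast
    moreover have "real ((1 + 1 + 2 * Suc w) choose (2 + Suc w)) \<le> 5 * real ((1 + 1 + 2 * w) choose (2 + w))" for w
      using binomial_ratio_near_diagonal[of 1 w] by (simp add: numeral_2_eq_2)
    ultimately show ?thesis
      using card_large_intersection_seq[OF assms(1) _ _ u, of "\<lambda>w. prefix X (s + 2 + 2 * w) - ?P"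
          "\<lambda>w. 1 + 1 + 2 * w" 5 2] by (simp add: numeral_2_eq_2)
  qed
  have "real (card {f \<in> A. f \<inter> ?P \<noteq> {}}) \<le> real s * \<tau>"
  proof -
    have "{f \<in> A. f \<inter> ?P \<noteq> {}} = (\<Union>x\<in>?P. {f \<in> A. x \<in> f})" by auto
    then have "card {f \<in> A. f \<inter> ?P \<noteq> {}} \<le> (\<Sum>x\<in>?P. card {f \<in> A. x \<in> f})"
      using card_UN_le[OF finP] by simp
    then have "real (card {f \<in> A. f \<inter> ?P \<noteq> {}}) \<le> (\<Sum>x\<in>?P. real (card {f \<in> A. x \<in> f}))"
      by (simp only: of_nat_le_iff flip: of_nat_sum)
    also have "\<dots> \<le> real (card ?P) * \<tau>"
      using deg prefix_subset[of X s] by (intro sum_bounded_above) blast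
    also have "\<dots> \<le> real s * \<tau>"
      using \<open>0 \<le> \<tau>\<close> card_prefix[OF assms(1), of s] by (intro mult_right_mono) auto
    finally show ?thesis .
  qed
  moreover have "card ({f \<in> A. f \<inter> ?P \<noteq> {}} \<union> ?W) \<le> card {f \<in> A. f \<inter> ?P \<noteq> {}} + card ?W"
    by (rule card_Un_le)
  ultimately have "card ({f \<in> A. f \<inter> ?P \<noteq> {}} \<union> ?W) < card A" using W large by linarith
  moreover have "finite ({f \<in> A. f \<inter> ?P \<noteq> {}} \<union> ?W)" using finA finN by simp
  ultimately have "\<not> A \<subseteq> {f \<in> A. f \<inter> ?P \<noteq> {}} \<union> ?W"
    by (meson card_mono not_less)
  then obtain f where f: "f \<in> A" "f \<inter> ?P = {}" "f \<notin> ?W" by auto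
  have light: "card (f \<inter> prefix X (s + 2 * w)) \<le> w" for w
  proof (cases w)
    case 0
    then show ?thesis using f by simp
  next
    case (Suc w')
    have "f \<inter> prefix X (s + 2 * w) = f \<inter> (prefix X (s + 2 + 2 * w') - ?P)" using f Suc by auto
    moreover have "\<not> 2 + w' \<le> card (f \<inter> (prefix X (s + 2 + 2 * w') - ?P))"
      using f assms(2) by blast
    ultimately show ?thesis using Suc by simp
  qed
  have "B \<subseteq> {g \<in> nsets X b. \<exists>w. s + 1 + w \<le> card (g \<inter> prefix X (s + 1 + 2 * w))}"
  proof
    fix g assume g: "g \<in> B"
    have "f \<subseteq> X" "g \<subseteq> X" using f g assms(2,3) by (auto simp: nsets_def)
    from shifted_cross_intersecting_heavy[OF assms(1,5,4) f(1) g this light]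
    show "g \<in> {g \<in> nsets X b. \<exists>w. s + 1 + w \<le> card (g \<inter> prefix X (s + 1 + 2 * w))}"
      using g assms(3) by auto
  qed
  then have "card B \<le> card {g \<in> nsets X b. \<exists>w. s + 1 + w \<le> card (g \<inter> prefix X (s + 1 + 2 * w))}"
    using finN by (intro card_mono) auto
  \<comment> \<open>The ratio \<open>s + 4\<close> is below 24 because \<open>s < 20\<close>; the
    leading coefficient is 1.\<close>
  also have "real \<dots> \<le> 24 / (24 - real (s + 4)) * real ((s + 1 + 2 * 0) choose (s + 1)) * D (u' + (s + 1))"
  proof (rule card_large_intersection_seq[OF assms(1) _ _ u'])
    show "card (prefix X (s + 1 + 2 * w)) \<le> s + 1 + 2 * w" for w
      using card_prefix[OF assms(1)] by simp
  qed (use \<open>s < 20\<close> binomial_ratio_near_diagonal prefix_subset in auto)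
  finally show ?thesis by simp
qed

text \<open>A point lies in at most \<open>D (u + 1)\<close> members, which serves as the degree
  bound for shifted families. Only sizes enter the claim, so it passes back through every
  shift.\<close>

lemma cross_intersecting_card_le:
  fixes X :: "nat set"
  assumes "finite X" "A \<subseteq> nsets X a" "B \<subseteq> nsets X b" "cross_intersecting A B"
    and u: "a + u = k" "card X + u \<le> n" and u': "b + u' = k" "card X + u' \<le> n"
    and "s < 20"
    and large: "real s * D (u + 1) + 24 / 19 * D (u + 2) < real (card A)"
  shows "real (card B) \<le> 24 / (20 - real s) * D (u' + (s + 1))"
proof -
  have "real s * D (u + 1) + 24 / 19 * D (u + 2) < real (card A) \<longrightarrow>
    real (card B) \<le> 24 / (20 - real s) * D (u' + (s + 1))"
    using assms(1-4)
  proof (induction A B rule: shift_induct)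
    case (base A B)
    have "real (card {f \<in> A. x \<in> f}) \<le> D (u + 1)" if "x \<in> X" for x
    proof -
      have "card {f \<in> A. x \<in> f} \<le> card {f \<in> nsets X a. {x} \<subseteq> f}"
        using base assms(1) by (intro card_mono) (auto simp: finite_imp_finite_nsets)
      also have "real \<dots> \<le> D (u + 1)"
        using card_supersets[OF assms(1) _ u, of "{x}"] that by simp
      finally show ?thesis by simp
    qed
    then show ?case
      using shifted_cross_intersecting_card_le[OF assms(1) base(1-4) u u' _ D_nonneg assms(9)] by blast
  next
    case (step A B i j)
    then show ?case by (simp add: card_shift)
  qed
  then show ?thesis using large by blast
qed

text \<open>The size gap applied to residues: fixing \<open>S\<close> raises \<open>u\<close> by
  \<open>card S\<close>, fixing \<open>T\<close> raises \<open>u'\<close> by \<open>card T\<close>.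
  Disjointness of \<open>S\<close> and \<open>T\<close> moves all intersections outside
  \<open>Z\<close>.\<close>

lemma trace_card_le:
  fixes X :: "nat set"
  assumes "finite X" "A \<subseteq> nsets X a" "B \<subseteq> nsets X b" "cross_intersecting A B"
    and u: "a + u = k" "card X + u \<le> n" and u': "b + u' = k" "card X + u' \<le> n"
    and ST: "Z \<subseteq> X" "S \<subseteq> Z" "T \<subseteq> Z" "S \<inter> T = {}" and "s < 20"
    and large: "real s * D (u + card S + 1) + 24 / 19 * D (u + card S + 2) < real (card (trace A Z S))"
  shows "real (card (trace B Z T)) \<le> 24 / (20 - real s) * D (u' + card T + (s + 1))"
proof (cases "trace B Z T = {}")
  case True
  then show ?thesis using D_nonneg \<open>s < 20\<close> by simp
next
  case B: False
  have "0 \<le> real s * D (u + card S + 1) + 24 / 19 * D (u + card S + 2)" using D_nonneg by simp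
  then have "trace A Z S \<noteq> {}" using large by auto
  then have S: "card S \<le> a" by (rule card_le_if_trace_nonempty[OF assms(2)])
  have T: "card T \<le> b" by (rule card_le_if_trace_nonempty[OF assms(3) B])
  have finZ: "finite Z" using ST assms(1) finite_subset by blast
  have cX: "card (X - Z) + card Z = card X"
    using assms(1) ST finZ by (metis card_Diff_subset card_mono le_add_diff_inverse2)
  have "card S \<le> card Z" "card T \<le> card Z" using ST finZ by (auto intro: card_mono)
  then show ?thesis
    using cross_intersecting_card_le[OF _ residue_subset_nsets[OF assms(2)] residue_subset_nsets[OF assms(3)]
        cross_intersecting_residue[OF assms(4) ST(4)], of Z "u + card S" "u' + card T" s]
      S T u u' cX assms(1,13) large by (simp add: card_residue)
qed

end

lemma trace_singleton: "trace F {x} {x} = {f \<in> F. x \<in> f}" "trace F {x} {} = {f \<in> F. x \<notin> f}"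
  unfolding trace_def by auto

lemma card_shift_member_le:
  assumes "finite A" "i \<noteq> j"
  shows "card {g \<in> shift i j A. i \<in> g} \<le> card {f \<in> A. i \<in> f} + card {f \<in> A. j \<in> f}"
proof -
  have "card {g \<in> shift i j A. i \<in> g} \<le> card ({f \<in> A. i \<in> f} \<union> {f \<in> A. j \<in> f})"
    using card_shift_Collect_le[OF assms(1), of i j "\<lambda>f. i \<in> f"]
    by (rule le_trans) (use assms in \<open>auto intro!: card_mono\<close>)
  then show ?thesis using card_Un_le le_trans by blast
qed

section \<open>Elements of high degree in cross-intersecting pairs\<close>

context sparse_uniform
begin

lemma D_antimono: "i \<le> j \<Longrightarrow> D j \<le> D i"
proof -
  assume "i \<le> j"
  then obtain w where "j = i + w" using le_iff_add by blast
  moreover have "D i / 24 ^ w \<le> D i"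
    using D_nonneg[of i] by (simp add: divide_le_eq mult_le_cancel_left1)
  ultimately show "D j \<le> D i" using D_add[of i w] by simp
qed

text \<open>The case \<open>s = 3\<close>: since \<open>D 4 \<le> D 3 / 24\<close>, the threshold
  \<open>3 * D 3 + 24 / 19 * D 4\<close> is at most \<open>13 / 4 * D 3\<close>. Both a pair in a
  \<open>k\<close>-uniform family and a single element in a \<open>(k - 1)\<close>-uniform one are
  covered.\<close>

lemma trace_small_of_pair:
  fixes X :: "nat set"
  assumes "finite X" "A \<subseteq> nsets X a" "B \<subseteq> nsets X b" "cross_intersecting A B"
    and "a + u = k" "card X + u \<le> n" "b + u' = k" "card X + u' \<le> n"
    and "Z \<subseteq> X" "S \<subseteq> Z" "T \<subseteq> Z" "S \<inter> T = {}"
    and uS: "u + card S = 2" and "13 / 4 * D 3 < real (card (trace A Z S))"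
  shows "real (card (trace B Z T)) \<le> 24 / 17 * D 4"
proof -
  have "real (card (trace B Z T)) \<le> 24 / (20 - real 3) * D (u' + card T + (3 + 1))"
    using D4_le assms(14) D_nonneg[of 3]
    by (intro trace_card_le[OF assms(1-12)]) (simp_all add: uS)
  also have "\<dots> \<le> 24 / 17 * D 4" using D_antimono[of 4 "u' + card T + 4"] by simp
  finally show ?thesis .
qed

text \<open>The case \<open>s = 2\<close>: the threshold \<open>2 * D 3 + 24 / 19 * D 4\<close> is
  at most \<open>9 / 4 * D 3\<close>, and \<open>24 / 18 * D 4\<close> is at most
  \<open>D 3 / 16\<close>.\<close>

lemma avoiding_small_of_degree:
  fixes X :: "nat set"
  assumes "finite X" "A \<subseteq> nsets X a" "B \<subseteq> nsets X a" "cross_intersecting A B"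
    and u: "a + 1 = k" "card X + 1 \<le> n" and "x \<in> X"
    and "9 / 4 * D 3 < real (card {f \<in> A. x \<in> f})"
  shows "real (card {f \<in> B. x \<notin> f}) \<le> D 3 / 16"
proof -
  have "real (card (trace B {x} {})) \<le> 24 / (20 - real 2) * D (1 + card ({} :: nat set) + (2 + 1))"
    using D4_le assms(7,8) D_nonneg[of 3]
    by (intro trace_card_le[OF assms(1-4) u u, where S = "{x}"])
       (simp_all add: trace_singleton eval_nat_numeral)
  then show ?thesis using D4_le D_nonneg[of 3] by (simp add: trace_singleton)
qed

text \<open>An element of degree above \<open>9 / 4 * D 3\<close> in one family lies in almost all
  members of the other, and then, by symmetry, of the first. Hence one element of moderate degree in
  \<open>A\<close> suffices.\<close>

lemma common_element:
  fixes X :: "nat set"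
  assumes "finite X" "A \<subseteq> nsets X a" "B \<subseteq> nsets X a" "cross_intersecting A B"
    and u: "a + 1 = k" "card X + 1 \<le> n"
    and "6 * D 3 < real (card A)" "6 * D 3 < real (card B)"
  shows "\<exists>w\<in>X. real (card {f \<in> A. w \<notin> f}) \<le> D 3 / 16 \<and> real (card {f \<in> B. w \<notin> f}) \<le> D 3 / 16"
proof -
  have *: "\<exists>w\<in>X. real (card {f \<in> A. w \<notin> f}) \<le> D 3 / 16 \<and> real (card {f \<in> B. w \<notin> f}) \<le> D 3 / 16"
    if AB: "A \<subseteq> nsets X a" "B \<subseteq> nsets X a" "cross_intersecting A B" "6 * D 3 < real (card B)"
      and x: "x \<in> X" "9 / 4 * D 3 < real (card {f \<in> A. x \<in> f})" for A B x
  proof -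
    have B: "real (card {f \<in> B. x \<notin> f}) \<le> D 3 / 16"
      using avoiding_small_of_degree[OF assms(1) AB(1-3) u x] .
    then have "9 / 4 * D 3 < real (card {f \<in> B. x \<in> f})"
      using card_split_member[OF finite_nsets_subset(1)[OF assms(1) AB(2)], of x] AB(4) D_nonneg[of 3]
      by linarith
    then have "real (card {f \<in> A. x \<notin> f}) \<le> D 3 / 16"
      using avoiding_small_of_degree[OF assms(1) AB(2,1) cross_intersecting_sym[OF AB(3)] u x(1)] by blast
    then show ?thesis using B x by blast
  qed
  have "6 * D 3 < real (card A) \<longrightarrow> 6 * D 3 < real (card B) \<longrightarrow>
    (\<exists>w\<in>X. real (card {f \<in> A. w \<notin> f}) \<le> D 3 / 16 \<and> real (card {f \<in> B. w \<notin> f}) \<le> D 3 / 16)"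
    using assms(1-4)
  proof (induction A B rule: shift_induct)
    case (base A B)
    show ?case
    proof (intro impI)
      assume L: "6 * D 3 < real (card A)" "6 * D 3 < real (card B)"
      \<comment> \<open>Smaller degrees would allow \<open>s = 2\<close>, because
        \<open>2 * 9 / 4 + 24 / 19 < 6\<close>, and \<open>B\<close> would be too small.\<close>
      have "\<exists>x\<in>X. 9 / 4 * D 3 < real (card {f \<in> A. x \<in> f})"
      proof (rule ccontr)
        assume "\<not> ?thesis"
        then have deg: "real (card {f \<in> A. x \<in> f}) \<le> 9 / 4 * D 3" if "x \<in> X" for x
          using that by (meson not_less)
        have "real 2 * (9 / 4 * D 3) + 24 / 19 * D (1 + 2) < real (card A)"
          using L(1) D_nonneg[of 3] by (simp add: eval_nat_numeral)
        from shifted_cross_intersecting_card_le[OF assms(1) base(1-4) u u deg _ _ this]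
        have "real (card B) \<le> 24 / (20 - real 2) * D (1 + (2 + 1))" using D_nonneg by simp
        then show False using L(2) D4_le D_nonneg[of 3] by simp
      qed
      then show "\<exists>w\<in>X. real (card {f \<in> A. w \<notin> f}) \<le> D 3 / 16 \<and> real (card {f \<in> B. w \<notin> f}) \<le> D 3 / 16"
        using *[OF base(1-3) L(2)] by blast
    qed
  next
    case (step A B i j)
    note fin = finite_nsets_subset(1)[OF assms(1) step(1)] finite_nsets_subset(1)[OF assms(1) step(2)]
    show ?case
    proof (intro impI)
      assume L: "6 * D 3 < real (card A)" "6 * D 3 < real (card B)"
      then obtain w where w: "w \<in> X" "real (card {f \<in> shift i j A. w \<notin> f}) \<le> D 3 / 16"
          "real (card {f \<in> shift i j B. w \<notin> f}) \<le> D 3 / 16"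
        using step(7) by (auto simp: card_shift)
      show "\<exists>w\<in>X. real (card {f \<in> A. w \<notin> f}) \<le> D 3 / 16 \<and> real (card {f \<in> B. w \<notin> f}) \<le> D 3 / 16"
      proof (cases "w = i")
        case False
        then show ?thesis
          using w card_avoiding_le_shift[OF fin(1) False, of j] card_avoiding_le_shift[OF fin(2) False, of j]
          by (intro bexI[of _ w]) linarith+
      next
        case True
        \<comment> \<open>The shift may have merged the degrees of \<open>i\<close> and
          \<open>j\<close>; a total above \<open>5 * D 3\<close> leaves one of them above
          \<open>9 / 4 * D 3\<close>.\<close>
        have "finite (shift i j A)" unfolding shift_def using fin by simp
        from card_split_member[OF this, of i] w(2) L(1) True
        have "5 * D 3 < real (card {f \<in> shift i j A. i \<in> f})"
          using D_nonneg[of 3] by (simp add: card_shift)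
        then have "5 * D 3 < real (card {f \<in> A. i \<in> f}) + real (card {f \<in> A. j \<in> f})"
          using card_shift_member_le[OF fin(1), of i j] step(6) by linarith
        then have "9 / 4 * D 3 < real (card {f \<in> A. i \<in> f}) \<or> 9 / 4 * D 3 < real (card {f \<in> A. j \<in> f})"
          using D_nonneg[of 3] by linarith
        then show ?thesis using *[OF step(1-3) L(2)] step(4,5) by blast
      qed
    qed
  qed
  then show ?thesis using assms by blast
qed

text \<open>For shifted families, degrees of at most \<open>8 * D 3\<close> would make
  \<open>B\<close> too small, as \<open>2 * 8 + 24 / 19 < 19\<close>. Undoing a shift may halve a
  degree; the gap argument \<open>via\<close> restores it, possibly at another element.\<close>

lemma high_degree_element:
  fixes X :: "nat set"
  assumes "finite X" "A \<subseteq> nsets X a" "B \<subseteq> nsets X k" "cross_intersecting A B"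
    and u: "a + 1 = k" "card X + 1 \<le> n"
    and "19 * D 3 < real (card A)" "7 * D 3 < real (card B)"
  shows "\<exists>y\<in>X. 8 * D 3 < real (card {f \<in> A. y \<in> f})"
proof -
  have u': "k + 0 = k" "card X + 0 \<le> n" using u by simp_all
  have "19 * D 3 < real (card A) \<longrightarrow> 7 * D 3 < real (card B) \<longrightarrow>
    (\<exists>y\<in>X. 8 * D 3 < real (card {f \<in> A. y \<in> f}))"
    using assms(1-4)
  proof (induction A B rule: shift_induct)
    case (base A B)
    show ?case
    proof (intro impI, rule ccontr)
      assume L: "19 * D 3 < real (card A)" "7 * D 3 < real (card B)"
        and "\<not> (\<exists>y\<in>X. 8 * D 3 < real (card {f \<in> A. y \<in> f}))"
      then have deg: "real (card {f \<in> A. x \<in> f}) \<le> 8 * D 3" if "x \<in> X" for x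
        using that by (meson not_less)
      have "real 2 * (8 * D 3) + 24 / 19 * D (1 + 2) < real (card A)"
        using L(1) D_nonneg[of 3] by (simp add: eval_nat_numeral)
      from shifted_cross_intersecting_card_le[OF assms(1) base(1-4) u u' deg _ _ this]
      have "real (card B) \<le> 24 / (20 - real 2) * D (0 + (2 + 1))" using D_nonneg by simp
      then show False using L(2) D_nonneg[of 3] by simp
    qed
  next
    case (step A B i j)
    note fin = finite_nsets_subset(1)[OF assms(1) step(1)] finite_nsets_subset(1)[OF assms(1) step(2)]
    \<comment> \<open>If \<open>v\<close> has degree between \<open>4 * D 3\<close> and
      \<open>8 * D 3\<close>, almost all of \<open>B\<close> contains \<open>v\<close>. The members
      of \<open>A\<close> avoiding \<open>v\<close> and the residue of \<open>B\<close> at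
      \<open>v\<close> are both \<open>(k - 1)\<close>-uniform and large, so they have a common
      element, of degree above \<open>8 * D 3\<close> in \<open>A\<close>.\<close>
    have via: "\<exists>y\<in>X. 8 * D 3 < real (card {f \<in> A. y \<in> f})"
      if L: "19 * D 3 < real (card A)" "7 * D 3 < real (card B)"
        and v: "v \<in> X" "4 * D 3 < real (card {f \<in> A. v \<in> f})" for v
    proof (cases "8 * D 3 < real (card {f \<in> A. v \<in> f})")
      case True
      then show ?thesis using v by blast
    next
      case False
      then have Av: "11 * D 3 < real (card {f \<in> A. v \<notin> f})"
        using card_split_member[OF fin(1), of v] L(1) by linarith
      have "real (card (trace B {v} {})) \<le> 24 / 17 * D 4"
        using v D_nonneg[of 3]
        by (intro trace_small_of_pair[OF assms(1) step(1-3) u u', where S = "{v}"]) (simp_all add: trace_singleton)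
      then have "6 * D 3 < real (card {f \<in> B. v \<in> f})"
        using card_split_member[OF fin(2), of v] L(2) D4_le D_nonneg[of 3]
        by (simp add: trace_singleton)
      then have B: "6 * D 3 < real (card (residue B {v} {v}))" by (simp add: card_residue trace_singleton)
      have resB: "residue B {v} {v} \<subseteq> nsets (X - {v}) a"
        using residue_subset_nsets[OF step(2), of "{v}" "{v}"] u by (simp flip: u(1))
      have resA: "residue A {v} {} \<subseteq> nsets (X - {v}) a"
        using residue_subset_nsets[OF step(1), of "{v}" "{}"] by simp
      have eqA: "residue A {v} {} = {f \<in> A. v \<notin> f}"
        unfolding residue_def trace_singleton by force
      have A: "6 * D 3 < real (card (residue A {v} {}))"
        unfolding eqA using Av D_nonneg[of 3] by linarith
      have cX: "card (X - {v}) + 1 \<le> n" using u(2) card_Diff1_le[of X v] by linarith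
      from common_element[OF _ resA resB cross_intersecting_residue[OF step(3)] u(1) cX A B] assms(1)
      obtain w where w: "w \<in> X" "real (card {f \<in> {f \<in> A. v \<notin> f}. w \<notin> f}) \<le> D 3 / 16"
        unfolding eqA by auto
      have "card {f \<in> {f \<in> A. v \<notin> f}. w \<in> f} \<le> card {f \<in> A. w \<in> f}"
        using fin by (intro card_mono) auto
      moreover have "card {f \<in> A. v \<notin> f} = card {f \<in> {f \<in> A. v \<notin> f}. w \<in> f} + card {f \<in> {f \<in> A. v \<notin> f}. w \<notin> f}"
        using fin by (intro card_split_member) simp
      ultimately have "8 * D 3 < real (card {f \<in> A. w \<in> f})"
        using w(2) Av D_nonneg[of 3] by linarith
      then show ?thesis using w(1) by blast
    qed
    show ?case
    proof (intro impI)
      assume L: "19 * D 3 < real (card A)" "7 * D 3 < real (card B)"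
      then obtain y where y: "y \<in> X" "8 * D 3 < real (card {f \<in> shift i j A. y \<in> f})"
        using step(7) by (auto simp: card_shift)
      show "\<exists>y\<in>X. 8 * D 3 < real (card {f \<in> A. y \<in> f})"
      proof (cases "y = i")
        case False
        have "finite (shift i j A)" unfolding shift_def using fin by simp
        from card_split_member[OF this, of y] card_split_member[OF fin(1), of y]
          card_avoiding_le_shift[OF fin(1) False, of j] y(2)
        have "8 * D 3 < real (card {f \<in> A. y \<in> f})" by (simp add: card_shift)
        then show ?thesis using y(1) by blast
      next
        case True
        then have "8 * D 3 < real (card {f \<in> A. i \<in> f}) + real (card {f \<in> A. j \<in> f})"
          using card_shift_member_le[OF fin(1), of i j] step(6) y(2) by simp
        then have "4 * D 3 < real (card {f \<in> A. i \<in> f}) \<or> 4 * D 3 < real (card {f \<in> A. j \<in> f})"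
          by linarith
        then show ?thesis using via[OF L] step(4,5) by blast
      qed
    qed
  qed
  then show ?thesis using assms by blast
qed

end

subsection \<open>Structure of large intersecting families\<close>

lemma card_residue_avoiding:
  assumes "w \<notin> Z"
  shows "card {g \<in> residue F Z S. w \<notin> g} = card {f \<in> trace F Z S. w \<notin> f}"
proof -
  have "{g \<in> residue F Z S. w \<notin> g} = residue {f \<in> F. w \<notin> f} Z S"
    using assms unfolding residue_def trace_def by auto
  moreover have "trace {f \<in> F. w \<notin> f} Z S = {f \<in> trace F Z S. w \<notin> f}"
    unfolding trace_def by auto
  ultimately show ?thesis by (simp add: card_residue)
qed

lemma card_avoiding_pair:
  assumes "finite F"
  shows "card {f \<in> F. x \<notin> f} \<le> card (trace F {x, y} {y}) + card (trace F {x, y} {})"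
proof -
  have "{f \<in> F. x \<notin> f} \<subseteq> trace F {x, y} {y} \<union> trace F {x, y} {}" unfolding trace_def by auto
  then have "card {f \<in> F. x \<notin> f} \<le> card (trace F {x, y} {y} \<union> trace F {x, y} {})"
    using assms by (intro card_mono) (auto simp: trace_def)
  then show ?thesis using card_Un_le le_trans by blast
qed

lemma card_avoiding_triple:
  assumes "finite F"
  shows "card {f \<in> F. x \<notin> f} \<le> card (trace F {x, y, z} {y, z}) + card (trace F {x, y, z} {y})
    + card (trace F {x, y, z} {z}) + card (trace F {x, y, z} {})"
proof -
  let ?t = "trace F {x, y, z}"
  have "{f \<in> F. x \<notin> f} \<subseteq> ?t {y, z} \<union> ?t {y} \<union> ?t {z} \<union> ?t {}"
    unfolding trace_def by auto
  then have "card {f \<in> F. x \<notin> f} \<le> card (?t {y, z} \<union> ?t {y} \<union> ?t {z} \<union> ?t {})"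
    using assms by (intro card_mono) (auto simp: trace_def)
  also have "\<dots> \<le> card (?t {y, z} \<union> ?t {y} \<union> ?t {z}) + card (?t {})" by (rule card_Un_le)
  also have "card (?t {y, z} \<union> ?t {y} \<union> ?t {z}) \<le> card (?t {y, z} \<union> ?t {y}) + card (?t {z})"
    by (rule card_Un_le)
  also have "card (?t {y, z} \<union> ?t {y}) \<le> card (?t {y, z}) + card (?t {y})" by (rule card_Un_le)
  finally show ?thesis by simp
qed

text \<open>No moved set newly acquires the trace \<open>S\<close>: either its trace does not
  change, or its image contains \<open>i\<close> while \<open>S\<close> does not, or its image lacks
  \<open>j\<close> while \<open>S\<close> contains it.\<close>

lemma card_trace_shift_le:
  assumes "finite F" "i \<noteq> j"
    and "(i \<notin> Z \<and> j \<notin> Z) \<or> (i \<in> Z \<and> i \<notin> S) \<or> j \<in> S"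
  shows "card (trace (shift i j F) Z S) \<le> card (trace F Z S)"
proof -
  have *: "f \<inter> Z = S" if "insert i (f - {j}) \<inter> Z = S" for f
    using assms(3)
  proof (elim disjE)
    assume "i \<notin> Z \<and> j \<notin> Z"
    then have "insert i (f - {j}) \<inter> Z = f \<inter> Z" by blast
    then show ?thesis using that by simp
  qed (use assms(2) that in blast)+
  have "card (trace (shift i j F) Z S)
      \<le> card {f \<in> F. f \<inter> Z = S \<or> (j \<in> f \<and> i \<notin> f \<and> insert i (f - {j}) \<inter> Z = S)}"
    unfolding trace_def by (rule card_shift_Collect_le[OF assms(1)])
  also have "\<dots> \<le> card (trace F Z S)"
  proof (rule card_mono)
    show "{f \<in> F. f \<inter> Z = S \<or> (j \<in> f \<and> i \<notin> f \<and> insert i (f - {j}) \<inter> Z = S)} \<subseteq> trace F Z S"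
      unfolding trace_def using * by blast
  qed (use assms(1) in \<open>simp add: trace_def\<close>)
  finally show ?thesis .
qed

lemma card_trace_shift_le_add:
  assumes "finite F" "finite H"
    and "\<And>f. f \<in> F \<Longrightarrow> j \<in> f \<Longrightarrow> i \<notin> f \<Longrightarrow> insert i (f - {j}) \<inter> Z = S \<Longrightarrow> f \<in> H"
  shows "card (trace (shift i j F) Z S) \<le> card (trace F Z S) + card H"
proof -
  have "card (trace (shift i j F) Z S)
      \<le> card {f \<in> F. f \<inter> Z = S \<or> (j \<in> f \<and> i \<notin> f \<and> insert i (f - {j}) \<inter> Z = S)}"
    unfolding trace_def by (rule card_shift_Collect_le[OF assms(1)])
  also have "\<dots> \<le> card (trace F Z S \<union> H)"
    using assms unfolding trace_def by (intro card_mono) auto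
  also have "\<dots> \<le> card (trace F Z S) + card H" by (rule card_Un_le)
  finally show ?thesis .
qed

section \<open>Near stars, hubs and heavy triangles\<close>

context sparse_uniform
begin

definition near_star :: "real \<Rightarrow> nat set set \<Rightarrow> nat \<Rightarrow> bool" where
  "near_star c F x \<longleftrightarrow> real (card {f \<in> F. x \<notin> f}) \<le> c * D 3"

definition heavy_pair :: "real \<Rightarrow> nat set set \<Rightarrow> nat \<Rightarrow> nat \<Rightarrow> nat \<Rightarrow> bool" where
  "heavy_pair c F x y z \<longleftrightarrow> c * D 3 < real (card (trace F {x, y, z} {x, y}))"

text \<open>Two heavy pairs sharing \<open>x\<close>; \<open>13 / 4\<close> is the threshold from
  which \<open>trace_small_of_pair\<close> applies.\<close>

definition hub :: "nat set set \<Rightarrow> nat \<Rightarrow> nat \<Rightarrow> nat \<Rightarrow> bool" where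
  "hub F x y z \<longleftrightarrow> x \<noteq> y \<and> x \<noteq> z \<and> y \<noteq> z \<and> heavy_pair (13 / 4) F x y z \<and> heavy_pair (13 / 4) F x z y"

text \<open>Twice the threshold of \<open>hub\<close>: undoing a shift may split a heavy pair into
  two, one of which keeps half.\<close>

definition heavy_triangle :: "nat set set \<Rightarrow> nat \<Rightarrow> nat \<Rightarrow> nat \<Rightarrow> bool" where
  "heavy_triangle F x y z \<longleftrightarrow> x \<noteq> y \<and> x \<noteq> z \<and> y \<noteq> z \<and>
    heavy_pair (13 / 2) F x y z \<and> heavy_pair (13 / 2) F x z y \<and> heavy_pair (13 / 2) F y z x"

lemma heavy_pair_sym: "heavy_pair c F x y z \<longleftrightarrow> heavy_pair c F y x z"
  unfolding heavy_pair_def by (simp add: insert_commute)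

lemma heavy_pair_mono: "heavy_pair c F x y z \<Longrightarrow> d \<le> c \<Longrightarrow> heavy_pair d F x y z"
  unfolding heavy_pair_def using mult_right_mono[OF _ D_nonneg[of 3], of d c] by linarith

lemma heavy_triangle_perm:
  assumes "heavy_triangle F x y z"
  shows "heavy_triangle F y x z" "heavy_triangle F x z y"
  using assms unfolding heavy_triangle_def by (auto simp: heavy_pair_sym)

definition structured :: "nat set \<Rightarrow> nat set set \<Rightarrow> bool" where
  "structured V F \<longleftrightarrow> (\<exists>x\<in>V. near_star 7 F x) \<or> (\<exists>x\<in>V. \<exists>y\<in>V. \<exists>z\<in>V. heavy_triangle F x y z)"

text \<open>The constant 16 accommodates \<open>7 + 6\<close> when a shift is undone and
  \<open>12 + 4\<close> for fully shifted families.\<close>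

definition weakly_structured :: "nat set \<Rightarrow> nat set set \<Rightarrow> bool" where
  "weakly_structured V F \<longleftrightarrow> (\<exists>x\<in>V. near_star 16 F x) \<or> (\<exists>x\<in>V. \<exists>y\<in>V. \<exists>z\<in>V. hub F x y z)"

lemma trace_triple_small:
  assumes "finite V" "card V = n" "F \<subseteq> nsets V k" "cross_intersecting F F"
    and "{x, y, z} \<subseteq> V" "x \<noteq> y" "heavy_pair (13 / 4) F x y z" "T \<subseteq> {z}"
    and "z \<noteq> x" "z \<noteq> y"
  shows "real (card (trace F {x, y, z} T)) \<le> 24 / 17 * D 4"
    and "real (card (trace F {x, y, z} T)) \<le> D 3 / 16"
proof -
  show *: "real (card (trace F {x, y, z} T)) \<le> 24 / 17 * D 4"
    using assms unfolding heavy_pair_def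
    by (intro trace_small_of_pair[OF assms(1,3,3,4), where u = 0 and u' = 0 and S = "{x, y}"]) auto
  then show "real (card (trace F {x, y, z} T)) \<le> D 3 / 16" using D4_le D_nonneg[of 3] by linarith
qed

text \<open>The two heavy pairs make the traces \<open>{y}\<close>, \<open>{z}\<close> and
  \<open>{}\<close> tiny. If some pair of the triple has at most \<open>13 / 2 * D 3\<close>
  members, the opposite vertex is missed by at most \<open>(13 / 2 + 3 / 16) * D 3\<close>.\<close>

lemma hub_imp_structured:
  assumes V: "finite V" "card V = n" "F \<subseteq> nsets V k" "cross_intersecting F F"
    and xyz: "x \<in> V" "y \<in> V" "z \<in> V" and "hub F x y z"
  shows "structured V F"
proof -
  note fin = finite_nsets_subset(1)[OF V(1,3)]
  have h: "x \<noteq> y" "x \<noteq> z" "y \<noteq> z" "heavy_pair (13 / 4) F x y z" "heavy_pair (13 / 4) F x z y"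
    using assms(8) unfolding hub_def by auto
  let ?t = "\<lambda>S. real (card (trace F {x, y, z} S))"
  have z: "?t {z} \<le> D 3 / 16" and e: "?t {} \<le> D 3 / 16"
    using trace_triple_small(2)[OF V _ h(1,4)] xyz h by auto
  have y: "?t {y} \<le> D 3 / 16"
    using trace_triple_small(2)[OF V _ h(2,5), of "{y}"] xyz h by (auto simp: insert_commute)
  have D: "0 \<le> D 3" by (rule D_nonneg)
  show ?thesis
  proof (cases "heavy_pair (13 / 2) F y z x")
    case False
    then have "?t {y, z} \<le> 13 / 2 * D 3" unfolding heavy_pair_def by (simp add: insert_commute)
    then have "near_star 7 F x"
      using card_avoiding_triple[OF fin, of x y z] y z e D unfolding near_star_def by linarith
    then show ?thesis using xyz unfolding structured_def by blast
  next
    \<comment> \<open>The pair \<open>y\<close>, \<open>z\<close> comes first because its heaviness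
      makes the trace \<open>{x}\<close> tiny, as the other two cases require.\<close>
    case yz: True
    have x: "?t {x} \<le> D 3 / 16"
      using trace_triple_small(2)[OF V _ h(3) heavy_pair_mono[OF yz], of "{x}"] xyz h
      by (auto simp: insert_commute)
    show ?thesis
    proof (cases "heavy_pair (13 / 2) F x y z")
      case False
      then have "?t {x, y} \<le> 13 / 2 * D 3" unfolding heavy_pair_def by simp
      moreover have "{z, x, y} = {x, y, z}" by auto
      ultimately have "near_star 7 F z"
        using card_avoiding_triple[OF fin, of z x y] x y e D unfolding near_star_def by simp
      then show ?thesis using xyz unfolding structured_def by blast
    next
      case xy: True
      show ?thesis
      proof (cases "heavy_pair (13 / 2) F x z y")
        case False
        then have "?t {x, z} \<le> 13 / 2 * D 3" unfolding heavy_pair_def by (simp add: insert_commute)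
        moreover have "{y, x, z} = {x, y, z}" by auto
        ultimately have "near_star 7 F y"
          using card_avoiding_triple[OF fin, of y x z] x z e D unfolding near_star_def by simp
        then show ?thesis using xyz unfolding structured_def by blast
      next
        case True
        then have "heavy_triangle F x y z" using xy yz h unfolding heavy_triangle_def by simp
        then show ?thesis using xyz unfolding structured_def by blast
      qed
    qed
  qed
qed

text \<open>The residues of \<open>{x}\<close> and \<open>{y}\<close> are cross-intersecting and
  \<open>(k - 1)\<close>-uniform. Their common element \<open>w\<close> forms a heavy pair with both
  \<open>x\<close> and \<open>y\<close>.\<close>

lemma hub_of_two_heavy_elements:
  assumes V: "finite V" "card V = n" "F \<subseteq> nsets V k" "cross_intersecting F F"
    and xy: "x \<in> V" "y \<in> V" "x \<noteq> y"
    and L: "6 * D 3 < real (card (trace F {x, y} {x}))" "6 * D 3 < real (card (trace F {x, y} {y}))"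
  shows "\<exists>w\<in>V. hub F w x y"
proof -
  note fin = finite_nsets_subset(1)[OF V(1,3)]
  let ?Z = "{x, y}"
  have "trace F ?Z {x} \<noteq> {}" using L(1) D_nonneg[of 3] by auto
  then have "1 \<le> k" using card_le_if_trace_nonempty[OF V(3)] by fastforce
  then have k: "k - 1 + 1 = k" by simp
  have "card (V - ?Z) \<le> card (V - {x})" using V(1) by (intro card_mono) auto
  then have cV: "card (V - ?Z) + 1 \<le> n"
    using card_Suc_Diff1[OF V(1) xy(1)] V(2) by simp
  have sub: "residue F ?Z {x} \<subseteq> nsets (V - ?Z) (k - 1)" "residue F ?Z {y} \<subseteq> nsets (V - ?Z) (k - 1)"
    using residue_subset_nsets[OF V(3), of ?Z "{x}"] residue_subset_nsets[OF V(3), of ?Z "{y}"] by auto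
  obtain w where w: "w \<in> V - ?Z"
    "real (card {g \<in> residue F ?Z {x}. w \<notin> g}) \<le> D 3 / 16"
    "real (card {g \<in> residue F ?Z {y}. w \<notin> g}) \<le> D 3 / 16"
    using common_element[OF _ sub cross_intersecting_residue[OF V(4)] k cV] V(1) xy(3) L
    by (auto simp: card_residue)
  have *: "heavy_pair (13 / 4) F w u v" if uv: "{u, v} = ?Z" "u \<noteq> v" for u v
  proof -
    have small: "real (card {f \<in> trace F ?Z {u}. w \<notin> f}) \<le> D 3 / 16"
      using w uv card_residue_avoiding[of w ?Z F "{u}"] by (auto simp: doubleton_eq_iff)
    have large: "6 * D 3 < real (card (trace F ?Z {u}))"
      using L uv by (auto simp: doubleton_eq_iff)
    have "trace F {w, u, v} {w, u} = {f \<in> trace F ?Z {u}. w \<in> f}"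
    proof -
      have "w \<noteq> u" "w \<noteq> v" using w(1) uv(1) by auto
      then have "f \<inter> {w, u, v} = {w, u} \<longleftrightarrow> w \<in> f \<and> u \<in> f \<and> v \<notin> f" for f using uv(2) by auto
      moreover have "f \<inter> {u, v} = {u} \<longleftrightarrow> u \<in> f \<and> v \<notin> f" for f using uv(2) by auto
      ultimately show ?thesis unfolding trace_def uv(1)[symmetric] by auto
    qed
    moreover have "card (trace F ?Z {u}) = card {f \<in> trace F ?Z {u}. w \<in> f} + card {f \<in> trace F ?Z {u}. w \<notin> f}"
      using fin by (intro card_split_member) (auto simp: trace_def)
    ultimately show ?thesis unfolding heavy_pair_def using small large D_nonneg[of 3] by simp
  qed
  have "heavy_pair (13 / 4) F w x y" "heavy_pair (13 / 4) F w y x" using *[of x y] *[of y x] xy by auto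
  then have "hub F w x y" using w(1) xy unfolding hub_def by auto
  then show ?thesis using w(1) by blast
qed

text \<open>If more than \<open>7 * D 3\<close> members miss \<open>x\<close>, the two residues at
  \<open>x\<close> yield \<open>y\<close> with \<open>{x, y}\<close> in more than
  \<open>8 * D 3\<close> members. Then almost all members missing \<open>x\<close> contain
  \<open>y\<close>; depending on how many contain \<open>x\<close> but not \<open>y\<close>, there
  is a hub or \<open>y\<close> is the centre of a near star.\<close>

lemma near_star_imp_structured:
  assumes V: "finite V" "card V = n" "F \<subseteq> nsets V k" "cross_intersecting F F"
    and large: "35 * D 3 < real (card F)" and x: "x \<in> V" "near_star 16 F x"
  shows "structured V F"
proof (cases "near_star 7 F x")
  case True
  then show ?thesis using x unfolding structured_def by blast
next
  case False
  note fin = finite_nsets_subset(1)[OF V(1,3)]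
  let ?A = "residue F {x} {x}" and ?B = "residue F {x} {}"
  have B: "7 * D 3 < real (card ?B)"
    using False unfolding near_star_def by (simp add: card_residue trace_singleton)
  have A: "19 * D 3 < real (card ?A)"
    using x(2) large card_split_member[OF fin, of x]
    unfolding near_star_def by (simp add: card_residue trace_singleton)
  have "trace F {x} {x} \<noteq> {}" using A D_nonneg[of 3] by (auto simp: residue_def)
  then have "1 \<le> k" using card_le_if_trace_nonempty[OF V(3)] by fastforce
  then have k: "k - 1 + 1 = k" by simp
  have cV: "card (V - {x}) + 1 \<le> n" using card_Suc_Diff1[OF V(1) x(1)] V(2) by simp
  have sub: "?A \<subseteq> nsets (V - {x}) (k - 1)" "?B \<subseteq> nsets (V - {x}) k"
    using residue_subset_nsets[OF V(3), of "{x}" "{x}"] residue_subset_nsets[OF V(3), of "{x}" "{}"] by auto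
  obtain y where y: "y \<in> V - {x}" "8 * D 3 < real (card {f \<in> ?A. y \<in> f})"
    using high_degree_element[OF _ sub cross_intersecting_residue[OF V(4)] k cV A B] V(1) by auto
  have "{f \<in> ?A. y \<in> f} = (\<lambda>f. f - {x}) ` trace F {x, y} {x, y}"
    using y(1) unfolding residue_def trace_def by auto
  then have xy: "8 * D 3 < real (card (trace F {x, y} {x, y}))"
    using y(2) card_image_le[of "trace F {x, y} {x, y}" "\<lambda>f. f - {x}"] fin by (simp add: trace_def)
  have none: "real (card (trace F {x, y} {})) \<le> D 3 / 16"
  proof -
    have "real (card (trace F {x, y} {})) \<le> 24 / 17 * D 4"
      using xy x y D_nonneg[of 3] V(2)
      by (intro trace_small_of_pair[OF V(1,3,3,4), where u = 0 and u' = 0 and S = "{x, y}"]) auto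
    then show ?thesis using D4_le D_nonneg[of 3] by linarith
  qed
  have Fy: "6 * D 3 < real (card (trace F {x, y} {y}))"
    using False none card_avoiding_pair[OF fin, of x y] D_nonneg[of 3] unfolding near_star_def by linarith
  show ?thesis
  proof (cases "6 * D 3 < real (card (trace F {x, y} {x}))")
    case True
    then obtain w where "w \<in> V" "hub F w x y"
      using hub_of_two_heavy_elements[OF V x(1) _ _ True Fy] y(1) by auto
    then show ?thesis using hub_imp_structured[OF V] x(1) y(1) by blast
  next
    case F: False
    have "{y, x} = {x, y}" by auto
    then have "near_star 7 F y"
      using F none card_avoiding_pair[OF fin, of y x] D_nonneg[of 3] unfolding near_star_def by simp
    then show ?thesis using y(1) unfolding structured_def by blast
  qed
qed

lemma weakly_structured_imp_structured:
  assumes "finite V" "card V = n" "F \<subseteq> nsets V k" "cross_intersecting F F"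
    and "35 * D 3 < real (card F)" "weakly_structured V F"
  shows "structured V F"
  using assms near_star_imp_structured hub_imp_structured unfolding weakly_structured_def by blast

text \<open>Traces controlled by \<open>keep\<close> survive undoing the shift. Any other heavy
  trace splits into two sources, one of which keeps half.\<close>

lemma heavy_triangle_shift_imp_hub:
  assumes V: "finite V" "card V = n" "F \<subseteq> nsets V k"
    and ij: "i \<in> V" "j \<in> V" "i \<noteq> j"
    and xyz: "x \<in> V" "y \<in> V" "z \<in> V" and tri: "heavy_triangle (shift i j F) x y z"
  shows "\<exists>x\<in>V. \<exists>y\<in>V. \<exists>z\<in>V. hub F x y z"
proof -
  note fin = finite_nsets_subset(1)[OF V(1,3)]
  have D: "0 \<le> D 3" by (rule D_nonneg)
  have keep: "heavy_pair c F x y z" if "heavy_pair c (shift i j F) x y z"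
    and "(i \<notin> {x, y, z} \<and> j \<notin> {x, y, z}) \<or> (i \<in> {x, y, z} \<and> i \<notin> {x, y}) \<or> j \<in> {x, y}"
    for c x y z
    using that(1) card_trace_shift_le[OF fin ij(3) that(2)] unfolding heavy_pair_def by linarith
  consider (inside) "i \<in> {x, y, z}" | (outside) "i \<notin> {x, y, z}" by blast
  then show ?thesis
  proof cases
    case outside
    \<comment> \<open>If \<open>j\<close> is a vertex, it is taken as the centre \<open>x\<close>:
      both pairs through it are then controlled by \<open>keep\<close>.\<close>
    have *: "hub F x y z" if "heavy_triangle (shift i j F) x y z" "i \<notin> {x, y, z}" "j \<notin> {y, z}" for x y z
    proof -
      have d: "x \<noteq> y" "x \<noteq> z" "y \<noteq> z" using that(1) unfolding heavy_triangle_def by auto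
      have "heavy_pair (13 / 2) F x y z" "heavy_pair (13 / 2) F x z y"
        using that d keep[of "13 / 2" x y z] keep[of "13 / 2" x z y] unfolding heavy_triangle_def by auto
      then show ?thesis using d heavy_pair_mono[of "13 / 2" F _ _ _ "13 / 4"] unfolding hub_def by auto
    qed
    consider "j \<notin> {y, z}" | "j = y" | "j = z" by blast
    then show ?thesis
    proof cases
      case 1
      then show ?thesis using *[OF tri] outside xyz by blast
    next
      case 2
      then have "hub F y x z"
        using *[OF heavy_triangle_perm(1)[OF tri]] outside tri unfolding heavy_triangle_def by auto
      then show ?thesis using xyz by blast
    next
      case 3
      then have "hub F z x y"
        using *[OF heavy_triangle_perm(1)[OF heavy_triangle_perm(2)[OF tri]]] outside tri unfolding heavy_triangle_def by auto
      then show ?thesis using xyz by blast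
    qed
  next
    case inside
    then obtain y z where yz: "y \<in> V" "z \<in> V" and T: "heavy_triangle (shift i j F) i y z" "j \<noteq> z"
    proof -
      obtain y z where "y \<in> V" "z \<in> V" "heavy_triangle (shift i j F) i y z"
        using inside xyz tri heavy_triangle_perm(1)[OF tri] heavy_triangle_perm(1)[OF heavy_triangle_perm(2)[OF tri]] by auto
      then show ?thesis using that heavy_triangle_perm(2) unfolding heavy_triangle_def by metis
    qed
    have d: "i \<noteq> y" "i \<noteq> z" "y \<noteq> z"
      and hp: "heavy_pair (13 / 2) (shift i j F) i y z" "heavy_pair (13 / 2) (shift i j F) i z y"
        "heavy_pair (13 / 2) (shift i j F) y z i"
      using T unfolding heavy_triangle_def by auto
    show ?thesis
    proof (cases "j = y")
      case True
      have "heavy_pair (13 / 2) F i y z" using keep[OF hp(1)] True by simp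
      then have iy: "heavy_pair (13 / 4) F i y z" "heavy_pair (13 / 4) F y i z"
        using heavy_pair_mono heavy_pair_sym by auto
      \<comment> \<open>With \<open>j = y\<close>, sets acquiring the trace \<open>{i, z}\<close>
        had the trace \<open>{y, z}\<close>. The hub centre is \<open>i\<close> or \<open>y\<close>,
        according to which source is heavy.\<close>
      have "card (trace (shift i j F) {i, z, y} {i, z})
        \<le> card (trace F {i, z, y} {i, z}) + card (trace F {y, z, i} {y, z})"
        using fin d True by (intro card_trace_shift_le_add) (auto simp: trace_def)
      then have "heavy_pair (13 / 4) F i z y \<or> heavy_pair (13 / 4) F y z i"
        using hp(2) unfolding heavy_pair_def by linarith
      then have "hub F i y z \<or> hub F y i z" using iy d unfolding hub_def by auto
      then show ?thesis using yz ij(1) by blast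
    next
      case False
      have F: "heavy_pair (13 / 2) F y z i" using keep[OF hp(3)] d by simp
      then have yzi: "heavy_pair (13 / 4) F y z i" using heavy_pair_mono by auto
      have "card (trace (shift i j F) {i, y, z} {i, y})
        \<le> card (trace F {i, y, z} {i, y}) + card (trace F {j, y, z} {j, y})"
        using fin d False T(2) by (intro card_trace_shift_le_add) (auto simp: trace_def)
      then consider "heavy_pair (13 / 4) F i y z" | "heavy_pair (13 / 4) F j y z"
        using hp(1) unfolding heavy_pair_def by linarith
      then show ?thesis
      proof cases
        case 1
        then have "hub F y i z" using yzi d heavy_pair_sym unfolding hub_def by auto
        then show ?thesis using yz ij(1) by blast
      next
        case 2
        \<comment> \<open>Replacing \<open>i\<close> by \<open>j\<close> in the triple loses only
          sets containing \<open>y\<close>, \<open>z\<close> and \<open>j\<close>, at most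
          \<open>D 3\<close> of them, and \<open>13 / 2 - 1\<close> still exceeds
          \<open>13 / 4\<close>.\<close>
        have "trace F {y, z, i} {y, z} \<subseteq> trace F {y, z, j} {y, z} \<union> {f \<in> nsets V k. {y, z, j} \<subseteq> f}"
          using V(3) unfolding trace_def by auto
        then have "card (trace F {y, z, i} {y, z})
            \<le> card (trace F {y, z, j} {y, z} \<union> {f \<in> nsets V k. {y, z, j} \<subseteq> f})"
          using fin V(1) by (intro card_mono) (auto simp: trace_def finite_imp_finite_nsets)
        also have "\<dots> \<le> card (trace F {y, z, j} {y, z}) + card {f \<in> nsets V k. {y, z, j} \<subseteq> f}"
          by (rule card_Un_le)
        finally have le: "card (trace F {y, z, i} {y, z})
          \<le> card (trace F {y, z, j} {y, z}) + card {f \<in> nsets V k. {y, z, j} \<subseteq> f}" .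
        have "real (card {f \<in> nsets V k. {y, z, j} \<subseteq> f}) \<le> D (0 + card {y, z, j})"
          using yz ij V by (intro card_supersets) auto
        also have "card {y, z, j} = 3" using d False T(2) by auto
        finally have "real (card {f \<in> nsets V k. {y, z, j} \<subseteq> f}) \<le> D 3" by simp
        then have "heavy_pair (13 / 4) F y z j"
          using le F D unfolding heavy_pair_def by linarith
        then have "hub F y j z" using 2 d False T(2) heavy_pair_sym unfolding hub_def by auto
        then show ?thesis using yz ij(2) by blast
      qed
    qed
  qed
qed

text \<open>Only a near star centred at \<open>i\<close> needs care. Members missing both
  \<open>i\<close> and \<open>j\<close> are unmoved, hence few; if one of \<open>i\<close>,
  \<open>j\<close> is rarely present without the other, the other is the centre of a near star, and
  otherwise both occur alone often enough for a hub.\<close>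

lemma structured_shift_imp_weakly_structured:
  assumes V: "finite V" "card V = n" "F \<subseteq> nsets V k" "cross_intersecting F F"
    and ij: "i \<in> V" "j \<in> V" "i \<noteq> j" and st: "structured V (shift i j F)"
  shows "weakly_structured V F"
proof -
  note fin = finite_nsets_subset(1)[OF V(1,3)]
  have D: "0 \<le> D 3" by (rule D_nonneg)
  from st consider (star) x where "x \<in> V" "near_star 7 (shift i j F) x"
    | (tri) x y z where "x \<in> V" "y \<in> V" "z \<in> V" "heavy_triangle (shift i j F) x y z"
    unfolding structured_def by blast
  then show ?thesis
  proof cases
    case tri
    then show ?thesis using heavy_triangle_shift_imp_hub[OF V(1-3) ij tri] unfolding weakly_structured_def by blast
  next
    case star
    show ?thesis
    proof (cases "x = i")
      case False
      then have "near_star 16 F x"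
        using star(2) card_avoiding_le_shift[OF fin False, of j] D unfolding near_star_def by linarith
      then show ?thesis using star(1) unfolding weakly_structured_def by blast
    next
      case True
      have "trace F {i, j} {} \<subseteq> {g \<in> shift i j F. i \<notin> g}"
      proof
        fix f assume f: "f \<in> trace F {i, j} {}"
        then have "shift_set i j F f = f" unfolding trace_def shift_set_def by auto
        then show "f \<in> {g \<in> shift i j F. i \<notin> g}" using f unfolding shift_def trace_def by force
      qed
      then have "card (trace F {i, j} {}) \<le> card {g \<in> shift i j F. i \<notin> g}"
        using fin by (intro card_mono) (auto simp: shift_def)
      then have none: "real (card (trace F {i, j} {})) \<le> 7 * D 3"
        using star(2) True unfolding near_star_def by simp
      consider "real (card (trace F {i, j} {j})) \<le> 6 * D 3" | "real (card (trace F {i, j} {i})) \<le> 6 * D 3"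
        | "6 * D 3 < real (card (trace F {i, j} {i}))" "6 * D 3 < real (card (trace F {i, j} {j}))"
        by linarith
      then show ?thesis
      proof cases
        case 1
        then have "near_star 16 F i"
          using none card_avoiding_pair[OF fin, of i j] D unfolding near_star_def by linarith
        then show ?thesis using ij unfolding weakly_structured_def by blast
      next
        case 2
        moreover have "{j, i} = {i, j}" by auto
        ultimately have "near_star 16 F j"
          using none card_avoiding_pair[OF fin, of j i] D unfolding near_star_def by simp
        then show ?thesis using ij unfolding weakly_structured_def by blast
      next
        case 3
        then show ?thesis
          using hub_of_two_heavy_elements[OF V ij 3] ij unfolding weakly_structured_def by blast
      qed
    qed
  qed
qed

end

section \<open>Fully shifted families and the return to the original family\<close>

lemma prefix_atLeastAtMost: "prefix {1..n} t = {1..min t n}"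
proof -
  have "{1..n} \<inter> {..x} = {1..x}" if "x \<le> n" for x using that by auto
  then show ?thesis unfolding prefix_def by auto
qed

context sparse_uniform
begin

text \<open>The prefix lemma with both sets equal to \<open>f\<close> shows that \<open>f\<close>
  contains more than half of some \<open>{1..v}\<close>. If \<open>f\<close> misses 1, either its
  trace on \<open>{1, 2, 3}\<close> is \<open>{2, 3}\<close> or it has \<open>3 + w\<close> of the
  first \<open>5 + 2 * w\<close> points for some \<open>w\<close>.\<close>

lemma shifted_imp_weakly_structured:
  assumes F: "F \<subseteq> nsets {1..n} k" "cross_intersecting F F" "shifted {1..n} F"
    and large: "35 * D 3 < real (card F)"
  shows "weakly_structured {1..n} F"
proof -
  note fin = finite_nsets_subset(1)[OF _ F(1)]
  have D: "0 \<le> D 3" by (rule D_nonneg)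
  have "k \<noteq> 0"
  proof
    assume "k = 0"
    then have "F \<subseteq> {{}}" using F(1) by auto
    then have "F = {}" using F(2) unfolding cross_intersecting_def by blast
    then show False using large D by simp
  qed
  then have n: "24 \<le> n" using nk by simp
  let ?t = "trace F {1, 2, 3}"
  let ?W = "{f \<in> nsets {1..n} k. \<exists>w. 3 + w \<le> card (f \<inter> prefix {1..n} (5 + 2 * w))}"
  have sub: "{f \<in> F. 1 \<notin> f} \<subseteq> ?t {2, 3} \<union> ?W"
  proof
    fix f assume "f \<in> {f \<in> F. 1 \<notin> f}"
    then have f: "f \<in> F" "1 \<notin> f" by auto
    then have fN: "f \<in> nsets {1..n} k" and fX: "f \<subseteq> {1..n}" using F(1) by (auto simp: nsets_def)
    have ffin: "finite f" using fX finite_subset by blast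
    obtain v where v: "v \<in> {1..n}" "card ({1..n} \<inter> {..v}) < card (f \<inter> {..v}) + card (f \<inter> {..v})"
      using shifted_cross_intersecting_prefix[OF _ F(3,2) f(1) f(1) fX fX] by auto
    define c where "c = card (f \<inter> {..v})"
    have "{1..n} \<inter> {..v} = {1..v}" using v(1) by auto
    then have "card ({1..n} \<inter> {..v}) = v" by (simp only: card_atLeastAtMost)
    then have vc: "v < 2 * c" using v(2) unfolding c_def by linarith
    have sub: "f \<inter> {..v} \<subseteq> {2..v}"
    proof
      fix x assume x: "x \<in> f \<inter> {..v}"
      then have "x \<noteq> 1" "1 \<le> x" using f(2) fX by auto
      then show "x \<in> {2..v}" using x by auto
    qed
    then have "c \<le> v - 1" unfolding c_def using card_mono[of "{2..v}" "f \<inter> {..v}"] by simp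
    then have "2 \<le> c" using vc v(1) by auto
    show "f \<in> ?t {2, 3} \<union> ?W"
    proof (cases "c = 2")
      case True
      then have "v = 3" using vc \<open>c \<le> v - 1\<close> by simp
      then have "f \<inter> {..v} \<subseteq> {2, 3}" using sub by auto
      then have "f \<inter> {..v} = {2, 3}" using True unfolding c_def by (intro card_subset_eq) auto
      then have "2 \<in> f" "3 \<in> f" by auto
      then show ?thesis using f unfolding trace_def by auto
    next
      case False
      then have w: "c = 3 + (c - 3)" using \<open>2 \<le> c\<close> by simp
      define w where "w = c - 3"
      have w: "c = 3 + w" using w unfolding w_def .
      have "f \<inter> {..v} \<subseteq> f \<inter> prefix {1..n} (5 + 2 * w)"
        using vc w fX unfolding prefix_atLeastAtMost by auto
      then have "3 + w \<le> card (f \<inter> prefix {1..n} (5 + 2 * w))"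
        using card_mono[of "f \<inter> prefix {1..n} (5 + 2 * w)" "f \<inter> {..v}"] ffin w unfolding c_def by simp
      then show ?thesis using fN by blast
    qed
  qed
  \<comment> \<open>The leading coefficient \<open>5 choose 3 = 10\<close> and ratio 4 give
    \<open>24 / 20 * 10 = 12\<close>.\<close>
  have W: "real (card ?W) \<le> 12 * D 3"
  proof -
    have "real (card ?W) \<le> 24 / (24 - 4) * real ((5 + 2 * 0) choose 3) * D (0 + 3)"
      using prefix_subset binomial_ratio_5_3 card_prefix[of "{1..n}"]
      by (intro card_large_intersection_seq[where t = "\<lambda>w. 5 + 2 * w"]) auto
    moreover have "(5 :: nat) choose 3 = 10" by (simp add: eval_nat_numeral)
    ultimately show ?thesis by simp
  qed
  have "card {f \<in> F. 1 \<notin> f} \<le> card (?t {2, 3} \<union> ?W)"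
    using fin by (intro card_mono[OF _ sub]) (auto simp: trace_def finite_imp_finite_nsets)
  also have "\<dots> \<le> card (?t {2, 3}) + card ?W" by (rule card_Un_le)
  finally have 1: "real (card {f \<in> F. 1 \<notin> f}) \<le> real (card (?t {2, 3})) + 12 * D 3" using W by linarith
  show ?thesis
  proof (cases "real (card (?t {2, 3})) \<le> 4 * D 3")
    case True
    then have "near_star 16 F 1" using 1 unfolding near_star_def by linarith
    then show ?thesis using n unfolding weakly_structured_def by force
  next
    case False
    \<comment> \<open>Shiftedness permits replacing 2 by 1, so the trace \<open>{1, 3}\<close> is
      heavy as well and 3 is the centre of a hub.\<close>
    have "card (?t {2, 3}) \<le> card (?t {1, 3})"
    proof (rule card_inj_on_le[of "\<lambda>f. insert 1 (f - {2})"])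
      show "inj_on (\<lambda>f. insert 1 (f - {2})) (?t {2, 3})"
        by (rule inj_on_inverseI[of _ "\<lambda>f. insert 2 (f - {1})"]) (auto simp: trace_def)
      show "(\<lambda>f. insert 1 (f - {2})) ` ?t {2, 3} \<subseteq> ?t {1, 3}"
      proof
        fix g assume "g \<in> (\<lambda>f. insert 1 (f - {2})) ` ?t {2, 3}"
        then obtain f where f: "f \<in> F" "f \<inter> {1, 2, 3} = {2, 3}" "g = insert 1 (f - {2})"
          by (auto simp: trace_def)
        have "v \<in> f \<longleftrightarrow> v \<in> {2, 3}" if "v \<in> {1, 2, 3}" for v using f(2) that by blast
        from this[of 1] this[of 2] this[of 3] have "2 \<in> f" "1 \<notin> f" "3 \<in> f" by simp_all
        moreover from this have "g \<in> F" using F(3) f n unfolding shifted_def by auto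
        ultimately show "g \<in> ?t {1, 3}" using f(3) unfolding trace_def by auto
      qed
      show "finite (?t {1, 3})" using fin by (simp add: trace_def)
    qed
    then have "hub F 3 2 1"
      using False D unfolding hub_def heavy_pair_def by (auto simp: insert_commute)
    then show ?thesis using n unfolding weakly_structured_def by force
  qed
qed

text \<open>Weak structure of the shift is upgraded to full structure by the size gaps, and full
  structure of the shift gives weak structure before it. The premise \<open>A = B\<close>
  specializes the induction on pairs to one family.\<close>

lemma intersecting_imp_structured:
  assumes "F \<subseteq> nsets {1..n} k" "cross_intersecting F F" "35 * D 3 < real (card F)"
  shows "structured {1..n} F"
proof -
  have fin: "finite {1..n}" "card {1..n} = n" by auto
  have "A = B \<longrightarrow> 35 * D 3 < real (card A) \<longrightarrow> weakly_structured {1..n} A"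
    if "A \<subseteq> nsets {1..n} k" "B \<subseteq> nsets {1..n} k" "cross_intersecting A B" for A B
    using fin(1) that
  proof (induction A B rule: shift_induct)
    case (base A B)
    then show ?case using shifted_imp_weakly_structured by blast
  next
    case (step A B i j)
    show ?case
    proof (intro impI)
      assume "A = B" and L: "35 * D 3 < real (card A)"
      then have A: "cross_intersecting A A" "weakly_structured {1..n} (shift i j A)"
        using step by (auto simp: card_shift)
      have "structured {1..n} (shift i j A)"
        using weakly_structured_imp_structured[OF fin shift_subset_nsets[OF step(1,4)]
            cross_intersecting_shift[OF A(1)] _ A(2)] L by (simp add: card_shift)
      then show "weakly_structured {1..n} A"
        using structured_shift_imp_weakly_structured[OF fin step(1) A(1) step(4,5)] step(6) by simp
    qed
  qed
  then show ?thesis using weakly_structured_imp_structured[OF fin] assms by blast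
qed

section \<open>From structure to the maximum degree\<close>

lemma structured_imp_high_degree:
  assumes F: "F \<subseteq> nsets {1..n} k" "cross_intersecting F F" "35 * D 3 < real (card F)"
    and st: "structured {1..n} F" and eps: "0 < \<epsilon>" "D 4 \<le> \<epsilon> * D 3"
  shows "\<exists>x\<in>{1..n}. (2 / 3 - \<epsilon>) * real (card F) < real (card {f \<in> F. x \<in> f})"
proof -
  have fin: "finite F" using finite_nsets_subset(1)[OF _ F(1)] by simp
  have D: "0 \<le> D 3" by (rule D_nonneg)
  have pos: "0 < \<epsilon> * real (card F)" using eps F(3) D by (intro mult_pos_pos) linarith+
  from st consider (star) x where "x \<in> {1..n}" "near_star 7 F x"
    | (tri) x y z where "x \<in> {1..n}" "y \<in> {1..n}" "z \<in> {1..n}" "heavy_triangle F x y z"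
    unfolding structured_def by blast
  then show ?thesis
  proof cases
    case star
    then have "2 / 3 * real (card F) \<le> real (card {f \<in> F. x \<in> f})"
      using card_split_member[OF fin, of x] F(3) D unfolding near_star_def by linarith
    then have "(2 / 3 - \<epsilon>) * real (card F) < real (card {f \<in> F. x \<in> f})"
      using pos by (simp add: left_diff_distrib)
    then show ?thesis using star(1) by blast
  next
    case tri
    have d: "x \<noteq> y" "x \<noteq> z" "y \<noteq> z" and h: "heavy_pair (13 / 4) F x y z"
      "heavy_pair (13 / 4) F x z y" "heavy_pair (13 / 4) F y z x"
      using tri(4) heavy_pair_mono[of "13 / 2" F _ _ _ "13 / 4"] unfolding heavy_triangle_def by auto
    have V: "finite {1..n}" "card {1..n} = n" by auto
    let ?t = "\<lambda>S. card (trace F {x, y, z} S)"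
    have z: "real (?t {z}) \<le> 24 / 17 * D 4" and e: "real (?t {}) \<le> 24 / 17 * D 4"
      using trace_triple_small(1)[OF V F(1,2) _ d(1) h(1)] tri d by auto
    have y: "real (?t {y}) \<le> 24 / 17 * D 4"
      using trace_triple_small(1)[OF V F(1,2) _ d(2) h(2), of "{y}"] tri d by (auto simp: insert_commute)
    have x: "real (?t {x}) \<le> 24 / 17 * D 4"
      using trace_triple_small(1)[OF V F(1,2) _ d(3) h(3), of "{x}"] tri d by (auto simp: insert_commute)
    \<comment> \<open>Members meeting the triple at least twice contribute 2 to the degree sum;
      those meeting it once fall short by 1, those missing it by 2. The five correction terms total
      at most \<open>120 / 17 * D 4\<close>.\<close>
    have "2 * card F \<le> card {f \<in> F. x \<in> f} + card {f \<in> F. y \<in> f} + card {f \<in> F. z \<in> f}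
      + ?t {x} + ?t {y} + ?t {z} + 2 * ?t {}"
    proof -
      let ?i = "\<lambda>P f. if P f then 1 else 0 :: nat"
      have c: "card {f \<in> F. P f} = (\<Sum>f\<in>F. ?i P f)" for P
        using fin by (simp add: sum.If_cases Int_def)
      have "2 * card F = (\<Sum>f\<in>F. 2)" by simp
      also have "\<dots> \<le> (\<Sum>f\<in>F. ?i (\<lambda>f. x \<in> f) f + ?i (\<lambda>f. y \<in> f) f + ?i (\<lambda>f. z \<in> f) f
        + ?i (\<lambda>f. f \<inter> {x, y, z} = {x}) f + ?i (\<lambda>f. f \<inter> {x, y, z} = {y}) f
        + ?i (\<lambda>f. f \<inter> {x, y, z} = {z}) f + 2 * ?i (\<lambda>f. f \<inter> {x, y, z} = {}) f)"
        by (rule sum_mono) auto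
      finally show ?thesis
        unfolding trace_def c by (simp add: sum.distrib sum_distrib_left)
    qed
    then have "2 * real (card F) \<le> real (card {f \<in> F. x \<in> f}) + real (card {f \<in> F. y \<in> f})
        + real (card {f \<in> F. z \<in> f}) + 120 / 17 * D 4"
      using x y z e by linarith
    moreover have "120 / 17 * D 4 < 3 * (\<epsilon> * real (card F))"
    proof -
      have "\<epsilon> * (35 * D 3) \<le> \<epsilon> * real (card F)" using eps F(3) by (intro mult_left_mono) auto
      then have "35 * D 4 \<le> \<epsilon> * real (card F)" using eps(2) by simp
      then show ?thesis using pos by linarith
    qed
    ultimately have "\<not> (\<forall>v\<in>{x, y, z}. real (card {f \<in> F. v \<in> f}) \<le> (2 / 3 - \<epsilon>) * real (card F))"
      by (simp add: left_diff_distrib)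
    then show ?thesis using tri by (auto simp: not_le)
  qed
qed

end

lemma card_link: "card (link F i) = card {f \<in> F. i \<in> f}"
proof -
  have "link F i = residue F {i} {i}" unfolding link_def residue_def trace_singleton by auto
  then show ?thesis by (simp add: card_residue trace_singleton)
qed

theorem theorem1p8:
  fixes \<epsilon> :: real and n k :: nat and \<F> :: "nat set set"
  assumes "0 < \<epsilon>" and "\<epsilon> \<le> 1 / 24"
    and "0 < n" and "0 < k"
    and "real n \<ge> real k / \<epsilon>"
    and "\<F> \<subseteq> nsets {1..n} k"
    and "\<F> \<noteq> {}"
    and "intersecting \<F>"
    and "card \<F> \<ge> 36 * binom (int n - 3) (int k - 3)"
  shows "max_rel_degree n \<F> > 2 / 3 - \<epsilon>"
proof -
  have kn: "real k \<le> \<epsilon> * real n" using assms(1,5) by (simp add: field_simps)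
  have "\<epsilon> * real n \<le> 1 / 24 * real n" using assms(2) by (intro mult_right_mono) auto
  then have "24 * k \<le> n" using kn by linarith
  then interpret sparse_uniform n k by unfold_locales
  have fin: "finite \<F>" using finite_nsets_subset(1)[OF _ assms(6)] by simp
  have pos: "0 < card \<F>" using fin assms(7) by (simp add: card_gt_0_iff)
  have D3: "real (binom (int n - 3) (int k - 3)) = D 3"
  proof (cases "3 \<le> k")
    case True
    then have "nat (int n - 3) = n - 3" "nat (int k - 3) = k - 3" "3 \<le> n" "k \<le> n"
      using \<open>24 * k \<le> n\<close> by auto
    then show ?thesis using True unfolding binom_def D_def by simp
  qed (simp add: binom_def D_def)
  have "real (36 * binom (int n - 3) (int k - 3)) \<le> real (card \<F>)"
    using assms(9) by (rule of_nat_mono)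
  then have "36 * D 3 \<le> real (card \<F>)" by (simp add: D3)
  \<comment> \<open>Since the family is nonempty, passing from 36 to 35 gives a strict bound even
    when \<open>D 3 = 0\<close>.\<close>
  then have large: "35 * D 3 < real (card \<F>)" using pos D_nonneg[of 3] by linarith
  have D4: "D 4 \<le> \<epsilon> * D 3"
  proof (cases "4 \<le> k")
    case True
    have p: "0 < real (n - 3)" using True \<open>24 * k \<le> n\<close> by simp
    \<comment> \<open>From \<open>k \<le> \<epsilon> * n\<close>, as the left side drops by 3 and
      the right side only by \<open>3 * \<epsilon>\<close>.\<close>
    have "real (k - 3) \<le> \<epsilon> * real (n - 3)"
      using kn assms(2) True \<open>24 * k \<le> n\<close> by (simp add: of_nat_diff right_diff_distrib)
    then have "real (k - 3) * D 3 \<le> (\<epsilon> * real (n - 3)) * D 3"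
      by (rule mult_right_mono[OF _ D_nonneg])
    moreover have "Suc 3 = 4" "Suc 3 \<le> k" using True by simp_all
    ultimately have "real (n - 3) * D 4 \<le> (\<epsilon> * real (n - 3)) * D 3"
      using D_Suc_eq[of 3] by (simp only:)
    then have "real (n - 3) * D 4 \<le> real (n - 3) * (\<epsilon> * D 3)" by (simp only: mult_ac)
    then show ?thesis using mult_le_cancel_left_pos[OF p] by blast
  next
    case False
    then have "D 4 = 0" unfolding D_def by simp
    then show ?thesis using assms(1) D_nonneg[of 3] by simp
  qed
  have cross: "cross_intersecting \<F> \<F>"
    using assms(8) unfolding intersecting_def cross_intersecting_def .
  obtain x where x: "x \<in> {1..n}" "(2 / 3 - \<epsilon>) * real (card \<F>) < real (card {f \<in> \<F>. x \<in> f})"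
    using structured_imp_high_degree[OF assms(6) cross large
        intersecting_imp_structured[OF assms(6) cross large] assms(1) D4] by blast
  have "2 / 3 - \<epsilon> < real (card (link \<F> x)) / real (card \<F>)"
    using x(2) pos by (simp add: card_link pos_less_divide_eq)
  also have "\<dots> \<le> max_rel_degree n \<F>"
    unfolding max_rel_degree_def using x(1) by (intro Max_ge) auto
  finally show ?thesis .
qed

end
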